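(* Let $p=p(n)\in[0,1]$ and $q=q(n)\in[0,1]$, and for each $n$ let $S_n$ be the skew-adjacency matrix of the randomly oriented graph $G_{n,p}^{\sigma}$, $\sigma=\sigma(q)$, on $n$ vertices. Let $$r=r(p,q)=\sqrt{(1+p(1-2q))^2\,pq+(1-p(1-2q))^2\,p(1-q)},$$ let $Y_n\in\mathbb{R}^{n\times n}$ be the skew-symmetric matrix whose entries above the diagonal are all $1$ and whose entries below the diagonal are all $-1$ (with zero diagonal), and let $$X_n=\frac{-\mathbf{i}S_n-\mathbf{i}p(1-2q)Y_n}{r},\qquad \mathbf{i}=\sqrt{-1},$$ which is a Hermitian matrix (defined whenever $r>0$, which holds for all large $n$ under the hypotheses below). Suppose that $nr^2\rightarrow\infty$ and $p(1-2q)\rightarrow 0$ as $n\rightarrow\infty$. Then, with probability $1$, the empirical spectral distribution $F_{n^{-1/2}X_n}$ of the matrix $n^{-1/2}X_n$ converges weakly, as $n\to\infty$, to the distribution function $F$ with density $$f(x)=\frac{1}{2\pi}\sqrt{4-x^2}\,\mathbf{1}_{|x|\le 2},$$ i.e. $\lim_{n\rightarrow\infty}F_{n^{-1/2}X_n}(x)=F(x)$ for all $x\in\mathbb{R}$ almost surely.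
   Context: Randomly oriented graph: let $V=\{v_1,\dots,v_n\}$. The Erdős–Rényi random graph $G_{n,p}$ on $V$ contains each of the $\binom n2$ possible edges independently with probability $p=p(n)$. The randomly oriented graph $G_{n,p}^{\sigma}$, with $\sigma=\sigma(q)$, is obtained from $G_{n,p}$ by orienting each edge $\{v_i,v_j\}$ ($i<j$) of $G_{n,p}$ as the arc $(v_i,v_j)$ with probability $q=q(n)$ and as $(v_j,v_i)$ with probability $1-q$, independently of each other. Skew-adjacency matrix: $S_n=(s_{ij})\in\mathbb{R}^{n\times n}$ is the real skew-symmetric matrix with $s_{ij}=1$ and $s_{ji}=-1$ if $(v_i,v_j)$ is an arc of $G_{n,p}^{\sigma}$, and $s_{ij}=s_{ji}=0$ if there is no arc between $v_i$ and $v_j$. Equivalently, $S_n$ is skew-symmetric with zero diagonal and its entries $s_{ij}$, $i<j$, are i.i.d. with $\operatorname{P}(s_{ij}=1)=pq$, $\operatorname{P}(s_{ij}=-1)=p(1-q)$, $\operatorname{P}(s_{ij}=0)=1-p$. The random matrices $S_n$ for all $n$ are taken to be defined on a common probability space; no assumption is made on their joint distribution for different $n$. Empirical spectral distribution: for a Hermitian matrix $M\in\mathbb{C}^{n\times n}$ with eigenvalues $\mu_1(M),\dots,\mu_n(M)$ (counted with multiplicity), $F_M(x)=\frac1n\cdot\#\{i\in\{1,\dots,n\}:\mu_i(M)\le x\}$ for $x\in\mathbb{R}$. *)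

theory Defs
  imports
    "HOL-Probability.Probability"
    "Jordan_Normal_Form.Char_Poly"
    "Jordan_Normal_Form.Schur_Decomposition"
begin

(* The vertices v_1, ..., v_n are represented by 0, ..., n-1 (the index base of the matrix
   library), and an undirected edge {v_i, v_j} with i < j by the pair (i, j). *)

definition possible_edges :: "nat \<Rightarrow> (nat \<times> nat) set" where
  "possible_edges n = {(i, j). i < j \<and> j < n}"

definition erdos_renyi_pmf :: "nat \<Rightarrow> real \<Rightarrow> (nat \<times> nat) set pmf" where
  "erdos_renyi_pmf n p =
     map_pmf (\<lambda>present. {e \<in> possible_edges n. present e})
       (Pi_pmf (possible_edges n) False (\<lambda>_. bernoulli_pmf p))"

(* An arc (v_i, v_j) is the pair (i, j), with i < j or j < i. *)

definition random_orientation_pmf :: "real \<Rightarrow> (nat \<times> nat) set \<Rightarrow> (nat \<times> nat) set pmf" where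
  "random_orientation_pmf q E =
     map_pmf (\<lambda>forward. (\<lambda>e. if forward e then e else prod.swap e) ` E)
       (Pi_pmf E False (\<lambda>_. bernoulli_pmf q))"

definition oriented_graph_pmf :: "nat \<Rightarrow> real \<Rightarrow> real \<Rightarrow> (nat \<times> nat) set pmf" where
  "oriented_graph_pmf n p q = bind_pmf (erdos_renyi_pmf n p) (random_orientation_pmf q)"

definition skew_adjacency_mat :: "nat \<Rightarrow> (nat \<times> nat) set \<Rightarrow> real mat" where
  "skew_adjacency_mat n D =
     mat n n (\<lambda>(i, j). if (i, j) \<in> D then 1 else if (j, i) \<in> D then -1 else 0)"

definition Y_mat :: "nat \<Rightarrow> real mat" where
  "Y_mat n = mat n n (\<lambda>(i, j). if i < j then 1 else if j < i then -1 else 0)"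

definition r_param :: "real \<Rightarrow> real \<Rightarrow> real" where
  "r_param p q =
     sqrt ((1 + p * (1 - 2 * q))\<^sup>2 * (p * q) + (1 - p * (1 - 2 * q))\<^sup>2 * (p * (1 - q)))"

definition X_mat :: "nat \<Rightarrow> real \<Rightarrow> real \<Rightarrow> real mat \<Rightarrow> complex mat" where
  "X_mat n p q S =
     (1 / complex_of_real (r_param p q)) \<cdot>\<^sub>m
       ((- \<i>) \<cdot>\<^sub>m map_mat complex_of_real S
        - (\<i> * complex_of_real (p * (1 - 2 * q))) \<cdot>\<^sub>m map_mat complex_of_real (Y_mat n))"

(* Intended for Hermitian M, whose eigenvalues are real, so that taking real parts loses nothing.
   Eigenvalues are counted with multiplicity, as roots of the characteristic polynomial. *)

definition esd :: "complex mat \<Rightarrow> real \<Rightarrow> real" where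
  "esd M x = real (size {# \<mu> \<in># proots (char_poly M). Re \<mu> \<le> x #}) / real (dim_row M)"

definition semicircle_density :: "real \<Rightarrow> real" where
  "semicircle_density x = (if \<bar>x\<bar> \<le> 2 then 1 / (2 * pi) * sqrt (4 - x\<^sup>2) else 0)"

definition semicircle_cdf :: "real \<Rightarrow> real" where
  "semicircle_cdf = cdf (density lborel (\<lambda>x. ennreal (semicircle_density x)))"

lemma mat_adjoint_X_mat:
  assumes "\<And>i j. (i, j) \<in> D \<Longrightarrow> (j, i) \<notin> D"
  shows "mat_adjoint (X_mat n p q (skew_adjacency_mat n D)) = X_mat n p q (skew_adjacency_mat n D)"
proof (rule eq_matI)
  fix i j
  assume "i < dim_row (X_mat n p q (skew_adjacency_mat n D))"
    and "j < dim_col (X_mat n p q (skew_adjacency_mat n D))"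
  then have ij: "i < n" "j < n"
    by (simp_all add: X_mat_def Y_mat_def)
  then show "mat_adjoint (X_mat n p q (skew_adjacency_mat n D)) $$ (i, j) =
      X_mat n p q (skew_adjacency_mat n D) $$ (i, j)"
    using assms[of i j] assms[of j i]
    by (auto simp: mat_adjoint_def X_mat_def Y_mat_def skew_adjacency_mat_def mat_of_rows_def)
qed (simp_all add: mat_adjoint_def X_mat_def Y_mat_def)

end

theory Submission
  imports Defs
begin

text \<open>
  Write \<open>W = X / sqrt n\<close>, \<open>G\<close> for the inverse of \<open>W - z\<close>, and \<open>s = tr G / n\<close> for \<open>Im z > 0\<close>; the
  Stieltjes transform of the semicircle law solves \<open>1 + z s + s\<^sup>2 = 0\<close>. The matrix \<open>W\<close> is Hermitian with
  independent centred entries above the diagonal, whose variance is \<open>(1 + o(1)) / n\<close> because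
  \<open>p (1 - 2 q) \<rightarrow> 0\<close>, and whose size is at most \<open>2 / sqrt (n r\<^sup>2) \<rightarrow> 0\<close>. Expanding \<open>G\<close> to second order in a
  single entry and its mirror image gives \<open>E (1 + z s + s\<^sup>2) \<rightarrow> 0\<close>. Changing one row and column of \<open>W\<close> moves
  \<open>tr G\<close> by at most \<open>2 / Im z\<close>, so \<open>1 + z s + s\<^sup>2\<close> concentrates exponentially fast around its mean
  (McDiarmid), which by Borel-Cantelli gives almost sure convergence to 0 for countably many \<open>z\<close>.
  A small defect forces \<open>Im s\<close> to be at least \<open>\<pi>\<close> times the semicircle density, up to a small error.
  Integrating \<open>Im s\<close> along a horizontal line smooths the spectral measure with a Cauchy kernel; hence
  each interval asymptotically carries at least its semicircle mass, and as the total mass is 1, exactly that mass.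
\<close>

section \<open>Resolvents\<close>

text \<open>The only rate at hand is n r^2 -> \<infinity>, possibly very slow. Bounded differences
  over single edges would give an exponent of order n r^2, which need not make the tails summable.
  Grouping the edges by their larger endpoint gives n blocks, each moving tr G / n by at most 2 / (n
  Im z) whatever the size of the entries, hence an exponent linear in n. Borel-Cantelli uses the
  tails for each n separately, so no joint law enters. The quadratic has two roots, and deciding
  which of them s approaches would take a continuity argument in z. A lower bound on Im s avoids
  this: near the root in the lower half plane, Im s \<ge> 0 forces the density itself to be small.
  The entries w are purely imaginary, so the mean of w^2 does not vanish. The term it leaves in the
  expansion contains an off-diagonal entry of G, and the Ward identity makes such terms negligible
  on average. Matrices are functions on an index set, so that deleting a row and column just shrinks
  the set.\<close>

definition resolvent_on :: "'i set \<Rightarrow> ('i \<Rightarrow> 'i \<Rightarrow> complex) \<Rightarrow> complex \<Rightarrow> ('i \<Rightarrow> 'i \<Rightarrow> complex) \<Rightarrow> bool"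
  where "resolvent_on I a z g \<longleftrightarrow> (\<forall>i\<in>I. \<forall>j\<in>I.
    (\<Sum>k\<in>I. a i k * g k j) = z * g i j + of_bool (i = j) \<and>
    (\<Sum>k\<in>I. g i k * a k j) = z * g i j + of_bool (i = j))"

definition hermitian_on :: "'i set \<Rightarrow> ('i \<Rightarrow> 'i \<Rightarrow> complex) \<Rightarrow> bool"
  where "hermitian_on I a \<longleftrightarrow> (\<forall>i\<in>I. \<forall>j\<in>I. a j i = cnj (a i j))"

lemma resolvent_onD:
  assumes "resolvent_on I a z g" "i \<in> I" "j \<in> I"
  shows "(\<Sum>k\<in>I. a i k * g k j) = z * g i j + of_bool (i = j)"
    and "(\<Sum>k\<in>I. g i k * a k j) = z * g i j + of_bool (i = j)"
  using assms unfolding resolvent_on_def by blast+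

lemma resolvent_on_cong:
  assumes "\<And>i j. i \<in> I \<Longrightarrow> j \<in> I \<Longrightarrow> a i j = b i j"
  shows "resolvent_on I a z g \<longleftrightarrow> resolvent_on I b z g"
proof -
  have e: "(\<Sum>k\<in>I. a i k * g k j) = (\<Sum>k\<in>I. b i k * g k j)"
    and e2: "(\<Sum>k\<in>I. g i k * a k j) = (\<Sum>k\<in>I. g i k * b k j)" if "i \<in> I" "j \<in> I" for i j
    using assms that by (auto intro!: sum.cong)
  show ?thesis unfolding resolvent_on_def by (intro ball_cong refl) (simp only: e e2)
qed

text \<open>Evaluate g b h and g a h through (b - w) h = 1 and g (a - z) = 1, and subtract. Two
  spectral parameters are allowed because the Ward identities compare z with its conjugate.\<close>

lemma resolvent_identity:
  assumes fin: "finite I" and g: "resolvent_on I a z g" and h: "resolvent_on I b w h"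
    and i: "i \<in> I" and j: "j \<in> I"
  shows "g i j - h i j =
    (\<Sum>k\<in>I. \<Sum>l\<in>I. g i k * (b k l - a k l) * h l j) + (z - w) * (\<Sum>k\<in>I. g i k * h k j)"
proof -
  have "(\<Sum>k\<in>I. \<Sum>l\<in>I. g i k * b k l * h l j) = (\<Sum>k\<in>I. g i k * (\<Sum>l\<in>I. b k l * h l j))"
    by (simp add: sum_distrib_left mult.assoc)
  also have "\<dots> = (\<Sum>k\<in>I. g i k * (w * h k j + of_bool (k = j)))"
    by (rule sum.cong) (simp_all add: resolvent_onD(1)[OF h _ j])
  also have "\<dots> = w * (\<Sum>k\<in>I. g i k * h k j) + (\<Sum>k\<in>I. if k = j then g i k else 0)"
    unfolding sum_distrib_left sum.distrib[symmetric] by (rule sum.cong) (auto simp: algebra_simps)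
  also have "(\<Sum>k\<in>I. if k = j then g i k else 0) = g i j"
    using fin j by simp
  finally have b: "(\<Sum>k\<in>I. \<Sum>l\<in>I. g i k * b k l * h l j) = w * (\<Sum>k\<in>I. g i k * h k j) + g i j" .
  have "(\<Sum>k\<in>I. \<Sum>l\<in>I. g i k * a k l * h l j) = (\<Sum>l\<in>I. \<Sum>k\<in>I. g i k * a k l * h l j)"
    by (rule sum.swap)
  also have "\<dots> = (\<Sum>l\<in>I. (\<Sum>k\<in>I. g i k * a k l) * h l j)"
    by (simp add: sum_distrib_right)
  also have "\<dots> = (\<Sum>l\<in>I. (z * g i l + of_bool (i = l)) * h l j)"
    by (rule sum.cong) (simp_all add: resolvent_onD(2)[OF g i])
  also have "\<dots> = z * (\<Sum>k\<in>I. g i k * h k j) + (\<Sum>k\<in>I. if i = k then h k j else 0)"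
    unfolding sum_distrib_left sum.distrib[symmetric] by (rule sum.cong) (auto simp: algebra_simps)
  also have "(\<Sum>k\<in>I. if i = k then h k j else 0) = h i j"
    using fin i by simp
  finally have a: "(\<Sum>k\<in>I. \<Sum>l\<in>I. g i k * a k l * h l j) = z * (\<Sum>k\<in>I. g i k * h k j) + h i j" .
  have "(\<Sum>k\<in>I. \<Sum>l\<in>I. g i k * (b k l - a k l) * h l j) =
     (\<Sum>k\<in>I. \<Sum>l\<in>I. g i k * b k l * h l j) - (\<Sum>k\<in>I. \<Sum>l\<in>I. g i k * a k l * h l j)"
    by (simp add: sum_subtractf algebra_simps)
  with a b show ?thesis by (simp add: algebra_simps)
qed

lemma resolvent_unique:
  assumes "finite I" "resolvent_on I a z g" "resolvent_on I a z h" "i \<in> I" "j \<in> I"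
  shows "g i j = h i j"
  using resolvent_identity[OF assms] by simp

lemma resolvent_adjoint:
  assumes herm: "hermitian_on I a" and g: "resolvent_on I a z g"
  shows "resolvent_on I a (cnj z) (\<lambda>i j. cnj (g j i))"
  unfolding resolvent_on_def
proof (intro ballI conjI)
  fix i j assume ij: "i \<in> I" "j \<in> I"
  have c: "a k l = cnj (a l k)" if "k \<in> I" "l \<in> I" for k l
    using herm that unfolding hermitian_on_def by blast
  have "(\<Sum>k\<in>I. a i k * cnj (g j k)) = cnj (\<Sum>k\<in>I. g j k * a k i)"
    unfolding cnj_sum complex_cnj_mult
    by (rule sum.cong[OF refl]) (subst c, use ij in \<open>simp_all add: mult.commute\<close>)
  then show "(\<Sum>k\<in>I. a i k * cnj (g j k)) = cnj z * cnj (g j i) + of_bool (i = j)"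
    using resolvent_onD(2)[OF g ij(2,1)] by auto
  have "(\<Sum>k\<in>I. cnj (g k i) * a k j) = cnj (\<Sum>k\<in>I. a j k * g k i)"
    unfolding cnj_sum complex_cnj_mult
    by (rule sum.cong[OF refl]) (subst c, use ij in \<open>simp_all add: mult.commute\<close>)
  then show "(\<Sum>k\<in>I. cnj (g k i) * a k j) = cnj z * cnj (g j i) + of_bool (i = j)"
    using resolvent_onD(1)[OF g ij(2,1)] by auto
qed

section \<open>Ward identities, entry bounds and Schur complements\<close>

context
  fixes I :: "'i set" and a g z
  assumes fin: "finite I" and herm: "hermitian_on I a" and g: "resolvent_on I a z g"
    and z: "Im z > 0"
begin

text \<open>The adjoint of \<open>g\<close> is the resolvent at \<open>cnj z\<close>, so the
  resolvent identity reads g - g* = (z - cnj z) g g*; this is its diagonal entry. The column version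
  takes the product in the other order.\<close>

lemma ward_row:
  assumes "i \<in> I"
  shows "(\<Sum>k\<in>I. (cmod (g i k))\<^sup>2) = Im (g i i) / Im z"
proof -
  have "g i i - cnj (g i i) = (z - cnj z) * (\<Sum>k\<in>I. g i k * cnj (g i k))"
    using resolvent_identity[OF fin g resolvent_adjoint[OF herm g] assms assms] by simp
  also have "(\<Sum>k\<in>I. g i k * cnj (g i k)) = of_real (\<Sum>k\<in>I. (cmod (g i k))\<^sup>2)"
    by (simp only: complex_norm_square[symmetric] of_real_sum)
  finally have "2 * Im (g i i) = 2 * Im z * (\<Sum>k\<in>I. (cmod (g i k))\<^sup>2)"
    unfolding complex_diff_cnj complex_eq_iff by simp
  then show ?thesis using z by (simp add: field_simps)
qed

lemma ward_column:
  assumes "i \<in> I"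
  shows "(\<Sum>k\<in>I. (cmod (g k i))\<^sup>2) = Im (g i i) / Im z"
proof -
  have "g i i - cnj (g i i) = (z - cnj z) * (\<Sum>k\<in>I. g k i * cnj (g k i))"
    using resolvent_identity[OF fin resolvent_adjoint[OF herm g] g assms assms]
    by (simp add: algebra_simps)
  also have "(\<Sum>k\<in>I. g k i * cnj (g k i)) = of_real (\<Sum>k\<in>I. (cmod (g k i))\<^sup>2)"
    by (simp only: complex_norm_square[symmetric] of_real_sum)
  finally have "2 * Im (g i i) = 2 * Im z * (\<Sum>k\<in>I. (cmod (g k i))\<^sup>2)"
    unfolding complex_diff_cnj complex_eq_iff by simp
  then show ?thesis using z by (simp add: field_simps)
qed

text \<open>The square of the diagonal entry is one term of the Ward sum, which is itself at most
  \<open>cmod (g i i) / Im z\<close>; dividing once gives the bound without any spectral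
  theorem.\<close>

lemma cmod_resolvent_diag_le:
  assumes "i \<in> I"
  shows "cmod (g i i) \<le> 1 / Im z"
proof (cases "g i i = 0")
  case False
  have "(cmod (g i i))\<^sup>2 \<le> (\<Sum>k\<in>I. (cmod (g i k))\<^sup>2)"
    by (rule member_le_sum[OF assms]) (use fin in auto)
  also have "\<dots> \<le> cmod (g i i) / Im z"
    unfolding ward_row[OF assms] using z abs_Im_le_cmod[of "g i i"] by (simp add: divide_right_mono)
  finally show ?thesis
    using False z by (simp add: power2_eq_square field_simps)
qed (use z in simp)

lemma ward_row_le:
  assumes "i \<in> I"
  shows "(\<Sum>k\<in>I. (cmod (g i k))\<^sup>2) \<le> 1 / (Im z)\<^sup>2"
proof -
  have "Im (g i i) \<le> 1 / Im z"
    using cmod_resolvent_diag_le[OF assms] abs_Im_le_cmod[of "g i i"] by simp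
  then show ?thesis
    unfolding ward_row[OF assms] using z by (simp add: power2_eq_square field_simps)
qed

lemma cmod_resolvent_le:
  assumes "i \<in> I" "j \<in> I"
  shows "cmod (g i j) \<le> 1 / Im z"
proof -
  have "(cmod (g i j))\<^sup>2 \<le> (\<Sum>k\<in>I. (cmod (g i k))\<^sup>2)"
    by (rule member_le_sum[OF assms(2)]) (use fin in auto)
  also have "\<dots> \<le> (1 / Im z)\<^sup>2"
    using ward_row_le[OF assms(1)] by (simp add: power_divide)
  finally show ?thesis
    by (rule power2_le_imp_le) (use z in simp)
qed

text \<open>By Ward, a vanishing diagonal entry would make the whole row vanish, contradicting g (a
  - z) = 1. This licenses the division in the Schur complement.\<close>

lemma resolvent_diag_nonzero:
  assumes "i \<in> I"
  shows "g i i \<noteq> 0"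
proof
  assume 0: "g i i = 0"
  then have "(\<Sum>k\<in>I. (cmod (g i k))\<^sup>2) = 0"
    using ward_row[OF assms] by simp
  then have "\<forall>k\<in>I. g i k = 0"
    using fin by (subst (asm) sum_nonneg_eq_0_iff) auto
  then show False
    using resolvent_onD(2)[OF g assms assms] 0 by simp
qed

text \<open>The rank-one correction makes row and column \<open>k\<close> vanish, so that sums over
  \<open>I - {k}\<close> may be extended to \<open>I\<close>, where \<open>g\<close> is known to
  invert.\<close>

lemma resolvent_minor:
  assumes k: "k \<in> I"
  shows "resolvent_on (I - {k}) a z (\<lambda>i j. g i j - g i k * g k j / g k k)"
  unfolding resolvent_on_def
proof (intro ballI conjI)
  fix i j assume "i \<in> I - {k}" "j \<in> I - {k}"
  then have ij: "i \<in> I" "j \<in> I" "i \<noteq> k" "j \<noteq> k" by auto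
  note nz = resolvent_diag_nonzero[OF k]
  have "(\<Sum>l\<in>I - {k}. a i l * (g l j - g l k * g k j / g k k)) =
      (\<Sum>l\<in>I. a i l * (g l j - g l k * g k j / g k k))"
    using fin k nz by (intro sum.mono_neutral_left) auto
  also have "\<dots> = (\<Sum>l\<in>I. a i l * g l j) - (\<Sum>l\<in>I. a i l * g l k) * (g k j / g k k)"
    by (simp add: sum_subtractf sum_distrib_left sum_divide_distrib algebra_simps)
  also have "\<dots> = z * (g i j - g i k * g k j / g k k) + of_bool (i = j)"
    using ij k by (simp add: resolvent_onD(1)[OF g] algebra_simps)
  finally show "(\<Sum>l\<in>I - {k}. a i l * (g l j - g l k * g k j / g k k)) =
      z * (g i j - g i k * g k j / g k k) + of_bool (i = j)" .
  have "(\<Sum>l\<in>I - {k}. (g i l - g i k * g k l / g k k) * a l j) =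
      (\<Sum>l\<in>I. (g i l - g i k * g k l / g k k) * a l j)"
    using fin k nz by (intro sum.mono_neutral_left) auto
  also have "\<dots> = (\<Sum>l\<in>I. g i l * a l j) - (g i k / g k k) * (\<Sum>l\<in>I. g k l * a l j)"
    by (simp add: sum_subtractf sum_distrib_left algebra_simps)
  also have "\<dots> = z * (g i j - g i k * g k j / g k k) + of_bool (i = j)"
    unfolding resolvent_onD(2)[OF g ij(1,2)] resolvent_onD(2)[OF g k ij(2)]
    using ij by (simp add: algebra_simps)
  finally show "(\<Sum>l\<in>I - {k}. (g i l - g i k * g k l / g k k) * a l j) =
      z * (g i j - g i k * g k j / g k k) + of_bool (i = j)" .
qed

text \<open>The difference of the traces is the diagonal entry of g^2 at \<open>k\<close>, divided
  by \<open>g k k\<close>. The arithmetic-geometric mean inequality and both Ward identities bound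
  the numerator by \<open>Im (g k k) / Im z\<close>, so the size of \<open>g k k\<close>
  cancels.\<close>

lemma trace_resolvent_minor:
  assumes k: "k \<in> I"
  shows "cmod ((\<Sum>i\<in>I. g i i) - (\<Sum>i\<in>I - {k}. g i i - g i k * g k i / g k k)) \<le> 1 / Im z"
proof -
  note nz = resolvent_diag_nonzero[OF k]
  have "(\<Sum>i\<in>I - {k}. g i i - g i k * g k i / g k k) = (\<Sum>i\<in>I. g i i - g i k * g k i / g k k)"
    using fin k nz by (intro sum.mono_neutral_left) auto
  then have "(\<Sum>i\<in>I. g i i) - (\<Sum>i\<in>I - {k}. g i i - g i k * g k i / g k k) = (\<Sum>i\<in>I. g i k * g k i) / g k k"
    by (simp add: sum_subtractf sum_divide_distrib)
  moreover have "cmod (\<Sum>i\<in>I. g i k * g k i) \<le> Im (g k k) / Im z"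
  proof -
    have "cmod (\<Sum>i\<in>I. g i k * g k i) \<le> (\<Sum>i\<in>I. cmod (g i k) * cmod (g k i))"
      by (rule sum_norm_le) (simp add: norm_mult)
    also have "\<dots> \<le> (\<Sum>i\<in>I. ((cmod (g i k))\<^sup>2 + (cmod (g k i))\<^sup>2) / 2)"
    proof (rule sum_mono)
      fix i show "cmod (g i k) * cmod (g k i) \<le> ((cmod (g i k))\<^sup>2 + (cmod (g k i))\<^sup>2) / 2"
        using zero_le_power2[of "cmod (g i k) - cmod (g k i)"] unfolding power2_diff by argo
    qed
    also have "\<dots> = Im (g k k) / Im z"
      by (simp add: sum_divide_distrib[symmetric] sum.distrib ward_row[OF k] ward_column[OF k])
    finally show ?thesis .
  qed
  moreover have "Im (g k k) \<le> cmod (g k k)" using abs_Im_le_cmod[of "g k k"] by simp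
  then have "Im (g k k) / Im z / cmod (g k k) \<le> 1 / Im z"
    using nz z by (simp add: divide_simps)
  ultimately show ?thesis
    using divide_right_mono[of "cmod (\<Sum>i\<in>I. g i k * g k i)" "Im (g k k) / Im z" "cmod (g k k)"]
    by (simp add: norm_divide)
qed

end

text \<open>The two matrices have a common minor, and each trace is within \<open>1 / Im z\<close> of the trace of
  the resolvent of that minor. Hence the bound does not depend on the size of the entries.\<close>

lemma trace_resolvent_diff_row:
  assumes fin: "finite I" and k: "k \<in> I" and z: "Im z > 0"
    and a: "hermitian_on I a" "resolvent_on I a z g"
    and b: "hermitian_on I b" "resolvent_on I b z h"
    and eq: "\<And>i j. i \<in> I - {k} \<Longrightarrow> j \<in> I - {k} \<Longrightarrow> a i j = b i j"
  shows "cmod ((\<Sum>i\<in>I. g i i) - (\<Sum>i\<in>I. h i i)) \<le> 2 / Im z"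
proof -
  let ?g = "\<lambda>i j. g i j - g i k * g k j / g k k" and ?h = "\<lambda>i j. h i j - h i k * h k j / h k k"
  have "resolvent_on (I - {k}) b z ?g"
    using resolvent_minor[OF fin a z k] resolvent_on_cong[of "I - {k}" a b] eq by blast
  then have "(\<Sum>i\<in>I - {k}. ?g i i) = (\<Sum>i\<in>I - {k}. ?h i i)"
    using resolvent_minor[OF fin b z k] fin
    by (intro sum.cong refl resolvent_unique[of "I - {k}" b z ?g ?h]) auto
  then have "cmod ((\<Sum>i\<in>I - {k}. ?g i i) - (\<Sum>i\<in>I. h i i)) \<le> 1 / Im z"
    using trace_resolvent_minor[OF fin b z k] by (simp only: norm_minus_commute)
  then have "cmod ((\<Sum>i\<in>I. g i i) - (\<Sum>i\<in>I. h i i)) \<le> 1 / Im z + 1 / Im z"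
    using norm_diff_triangle_le[OF trace_resolvent_minor[OF fin a z k]] by blast
  then show ?thesis by simp
qed

section \<open>Eigenvalues and the trace of the resolvent\<close>

lemma hermitian_quadratic_form_real:
  assumes "hermitian_on I a"
  shows "Im (\<Sum>i\<in>I. cnj (v i) * (\<Sum>j\<in>I. a i j * v j)) = 0"
proof -
  let ?S = "\<Sum>i\<in>I. \<Sum>j\<in>I. cnj (v i) * a i j * v j"
  have "cnj ?S = (\<Sum>i\<in>I. \<Sum>j\<in>I. cnj (v j) * a j i * v i)"
    unfolding cnj_sum
  proof (intro sum.cong refl)
    fix i j assume "i \<in> I" "j \<in> I"
    then have "a j i = cnj (a i j)" using assms unfolding hermitian_on_def by blast
    then show "cnj (cnj (v i) * a i j * v j) = cnj (v j) * a j i * v i" by simp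
  qed
  also have "\<dots> = ?S" by (rule sum.swap)
  finally have "?S \<in> \<real>" unfolding Reals_cnj_iff .
  then have "Im ?S = 0" unfolding complex_is_Real_iff .
  then show ?thesis by (simp add: sum_distrib_left mult.assoc)
qed

lemma hermitian_eigenvalue_real:
  fixes A :: "complex mat"
  assumes A: "A \<in> carrier_mat n n" and herm: "hermitian_on {..<n} (\<lambda>i j. A $$ (i, j))"
    and root: "poly (char_poly A) z = 0"
  shows "Im z = 0"
proof -
  obtain v where v: "v \<in> carrier_vec n" "v \<noteq> 0\<^sub>v n" "A *\<^sub>v v = z \<cdot>\<^sub>v v"
    using root A unfolding eigenvalue_root_char_poly[OF A, symmetric] eigenvalue_def eigenvector_def by auto
  have ev: "(\<Sum>j<n. A $$ (i, j) * v $ j) = z * v $ i" if "i < n" for i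
  proof -
    have "(A *\<^sub>v v) $ i = (\<Sum>j<n. A $$ (i, j) * v $ j)"
      using that A v(1) by (simp add: scalar_prod_def atLeast0LessThan)
    then show ?thesis using v that by simp
  qed
  have "(\<Sum>i<n. cnj (v $ i) * (\<Sum>j<n. A $$ (i, j) * v $ j)) = (\<Sum>i<n. cnj (v $ i) * (z * v $ i))"
    by (rule sum.cong) (simp_all add: ev)
  also have "\<dots> = z * of_real (\<Sum>i<n. (cmod (v $ i))\<^sup>2)"
    unfolding of_real_sum sum_distrib_left complex_norm_square by (simp add: algebra_simps)
  finally have "Im z * (\<Sum>i<n. (cmod (v $ i))\<^sup>2) = 0"
    using hermitian_quadratic_form_real[OF herm, of "\<lambda>i. v $ i"] by simp
  moreover obtain i where "i < n" "v $ i \<noteq> 0"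
    using v(1,2) by (metis carrier_vecD eq_vecI index_zero_vec(1) index_zero_vec(2))
  then have "(\<Sum>i<n. (cmod (v $ i))\<^sup>2) > 0"
    by (intro sum_pos2[of _ i]) auto
  ultimately show ?thesis by simp
qed

text \<open>The logarithmic derivative cleared of denominators; it turns a sum of principal minors
  into a sum over eigenvalues.\<close>

lemma poly_pderiv_prod_list_linear:
  fixes z :: "'a :: field_char_0"
  assumes "\<And>a. a \<in> set as \<Longrightarrow> z \<noteq> a"
  shows "poly (pderiv (\<Prod>a\<leftarrow>as. [:- a, 1:])) z =
    poly (\<Prod>a\<leftarrow>as. [:- a, 1:]) z * (\<Sum>a\<leftarrow>as. 1 / (z - a))"
  using assms
proof (induction as)
  case (Cons a as)
  let ?P = "\<Prod>a\<leftarrow>as. [:- a, 1:]"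
  have "poly (pderiv ([:- a, 1:] * ?P)) z = (z - a) * poly (pderiv ?P) z + poly ?P z"
    unfolding pderiv_mult by (simp add: pderiv_pCons left_diff_distrib)
  also have "\<dots> = (z - a) * (poly ?P z * (\<Sum>a\<leftarrow>as. 1 / (z - a))) + poly ?P z"
    using Cons by simp
  also have "\<dots> = (z - a) * poly ?P z * (1 / (z - a) + (\<Sum>a\<leftarrow>as. 1 / (z - a)))"
    using Cons.prems[of a] by (simp add: distrib_left)
  also have "(z - a) * poly ?P z = poly ([:- a, 1:] * ?P) z"
    by (simp add: left_diff_distrib)
  finally show ?case by simp
qed simp

text \<open>The adjugate yields an explicit inverse, and its diagonal entries are characteristic
  polynomials of principal minors, whose sum is the derivative of the characteristic polynomial.
  Thus existence and the trace formula, with multiplicities, come without diagonalisation.\<close>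

lemma ex_resolvent:
  fixes A :: "complex mat"
  assumes A: "A \<in> carrier_mat n n" and herm: "hermitian_on {..<n} (\<lambda>i j. A $$ (i, j))"
    and z: "Im z \<noteq> 0"
  shows "\<exists>g. resolvent_on {..<n} (\<lambda>i j. A $$ (i, j)) z g \<and>
    (\<Sum>i<n. g i i) = (\<Sum>\<mu>\<in>#proots (char_poly A). 1 / (\<mu> - z))"
proof -
  \<comment> \<open>\<open>B\<close> is z - A, so that its determinant is the characteristic
    polynomial at z; the sign is undone by the minus in \<open>g\<close>.\<close>
  define B where "B = - char_matrix A z"
  have B: "B \<in> carrier_mat n n" unfolding B_def using A by simp
  have Bij: "B $$ (i, j) = z * of_bool (i = j) - A $$ (i, j)" if "i < n" "j < n" for i j
    using that A by (auto simp: B_def char_matrix_def)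
  have det: "det B = poly (char_poly A) z"
    unfolding B_def using char_poly_matrix[OF A] by simp
  have nz: "det B \<noteq> 0"
    using hermitian_eigenvalue_real[OF A herm, of z] z det by auto
  define g where "g = (\<lambda>i j. - adj_mat B $$ (i, j) / det B)"
  note adj = adj_mat[OF B]
  have 1: "(\<Sum>k<n. B $$ (i, k) * adj_mat B $$ (k, j)) = det B * of_bool (i = j)"
    and 2: "(\<Sum>k<n. adj_mat B $$ (i, k) * B $$ (k, j)) = det B * of_bool (i = j)" if "i < n" "j < n" for i j
  proof -
    have "(B * adj_mat B) $$ (i, j) = (\<Sum>k<n. B $$ (i, k) * adj_mat B $$ (k, j))"
      using that B adj(1) by (simp add: scalar_prod_def atLeast0LessThan)
    then show "(\<Sum>k<n. B $$ (i, k) * adj_mat B $$ (k, j)) = det B * of_bool (i = j)"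
      unfolding adj(2) using that by (cases "i = j") auto
    have "(adj_mat B * B) $$ (i, j) = (\<Sum>k<n. adj_mat B $$ (i, k) * B $$ (k, j))"
      using that B adj(1) by (simp add: scalar_prod_def atLeast0LessThan)
    then show "(\<Sum>k<n. adj_mat B $$ (i, k) * B $$ (k, j)) = det B * of_bool (i = j)"
      unfolding adj(3) using that by (cases "i = j") auto
  qed
  have "resolvent_on {..<n} (\<lambda>i j. A $$ (i, j)) z g"
    unfolding resolvent_on_def
  proof (intro ballI conjI)
    fix i j assume "i \<in> {..<n}" "j \<in> {..<n}"
    then have ij: "i < n" "j < n" by auto
    have "(\<Sum>k<n. B $$ (i, k) * g k j) = - (\<Sum>k<n. B $$ (i, k) * adj_mat B $$ (k, j)) / det B"
      unfolding g_def by (simp add: sum_negf sum_divide_distrib)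
    then have "- of_bool (i = j) = (\<Sum>k<n. B $$ (i, k) * g k j)"
      using nz 1[OF ij] by simp
    also have "\<dots> = (\<Sum>k<n. (if i = k then z * g k j else 0) - A $$ (i, k) * g k j)"
      by (rule sum.cong) (use ij in \<open>auto simp: Bij algebra_simps\<close>)
    also have "\<dots> = z * g i j - (\<Sum>k<n. A $$ (i, k) * g k j)"
      using ij by (simp add: sum_subtractf)
    finally show "(\<Sum>k<n. A $$ (i, k) * g k j) = z * g i j + of_bool (i = j)"
      by (simp add: algebra_simps)
    have "(\<Sum>k<n. g i k * B $$ (k, j)) = - (\<Sum>k<n. adj_mat B $$ (i, k) * B $$ (k, j)) / det B"
      unfolding g_def by (simp add: sum_negf sum_divide_distrib)
    then have "- of_bool (i = j) = (\<Sum>k<n. g i k * B $$ (k, j))"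
      using nz 2[OF ij] by simp
    also have "\<dots> = (\<Sum>k<n. (if k = j then z * g i k else 0) - g i k * A $$ (k, j))"
      by (rule sum.cong) (use ij in \<open>auto simp: Bij algebra_simps\<close>)
    also have "\<dots> = z * g i j - (\<Sum>k<n. g i k * A $$ (k, j))"
      using ij by (simp add: sum_subtractf)
    finally show "(\<Sum>k<n. g i k * A $$ (k, j)) = z * g i j + of_bool (i = j)"
      by (simp add: algebra_simps)
  qed
  moreover have "(\<Sum>i<n. g i i) = (\<Sum>\<mu>\<in>#proots (char_poly A). 1 / (\<mu> - z))"
  proof -
    obtain as where as: "char_poly A = (\<Prod>a\<leftarrow>as. [:- a, 1:])"
      using char_poly_factorized[OF A] by auto
    have noroot: "z \<noteq> a" if "a \<in> set as" for a
      using nz det that unfolding as poly_prod_list by (auto simp: prod_list_zero_iff)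
    \<comment> \<open>By Cramer's rule the trace is the negative logarithmic derivative of the characteristic polynomial.\<close>
    have minor: "adj_mat B $$ (i, i) = poly (char_poly (mat_delete A i i)) z" if i: "i < n" for i
    proof -
      have m: "mat_delete A i i \<in> carrier_mat (n - 1) (n - 1)" "mat_delete B i i \<in> carrier_mat (n - 1) (n - 1)"
        using A B by (auto intro: mat_delete_carrier)
      have "mat_delete B i i = - char_matrix (mat_delete A i i) z"
        using A B i
        by (intro eq_matI) (auto simp: mat_delete_def Bij char_matrix_def)
      then show ?thesis
        unfolding char_poly_matrix[OF m(1)] using i B by (simp add: adj_mat_def cofactor_def)
    qed
    have "det B * (\<Sum>i<n. g i i) = - (\<Sum>i<n. poly (char_poly (mat_delete A i i)) z)"
      unfolding g_def using nz by (simp add: sum_distrib_left sum_negf minor)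
    also have "\<dots> = - poly (pderiv (char_poly A)) z"
      unfolding pderiv_char_poly[OF A] by (simp add: poly_sum)
    also have "\<dots> = - (det B * (\<Sum>a\<leftarrow>as. 1 / (z - a)))"
      unfolding det as by (subst poly_pderiv_prod_list_linear) (use noroot in auto)
    finally have "(\<Sum>i<n. g i i) = - (\<Sum>a\<leftarrow>as. 1 / (z - a))"
      using nz by (metis mult_cancel_left mult_minus_right)
    also have "\<dots> = (\<Sum>a\<leftarrow>as. 1 / (a - z))"
      by (induction as) (simp_all add: minus_divide_right)
    also have "\<dots> = (\<Sum>\<mu>\<in>#mset as. 1 / (\<mu> - z))"
      by (metis mset_map sum_mset_sum_list)
    also have "mset as = proots (char_poly A)"
    proof -
      have nonzero: "0 \<notin> set (map (\<lambda>a. [:- a, 1:]) as)" by auto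
      have "(\<Sum>x\<leftarrow>map (\<lambda>a. [:- a, 1:]) as. proots x) = mset as"
        by (induction as) auto
      then show ?thesis unfolding as using proots_prod_list[OF nonzero] by simp
    qed
    finally show ?thesis .
  qed
  ultimately show ?thesis by blast
qed

section \<open>The semicircle law\<close>

text \<open>Trading the case distinction for \<open>max\<close> makes continuity on the whole line
  immediate.\<close>

lemma semicircle_density_alt: "semicircle_density x = sqrt (max 0 (4 - x\<^sup>2)) / (2 * pi)"
proof (cases "\<bar>x\<bar> \<le> 2")
  case True
  then have "x\<^sup>2 \<le> 4" using abs_le_square_iff[of x 2] by simp
  then show ?thesis using True by (simp add: semicircle_density_def max_def)
next
  case False
  then have "x\<^sup>2 > 4" using abs_le_square_iff[of x 2] by simp
  then show ?thesis using False by (simp add: semicircle_density_def max_def)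
qed

lemma continuous_on_semicircle_density: "continuous_on S semicircle_density"
  unfolding semicircle_density_alt[abs_def] by (intro continuous_intros) auto

lemma semicircle_density_nonneg: "0 \<le> semicircle_density x"
  unfolding semicircle_density_alt by simp

lemma semicircle_density_le: "semicircle_density x \<le> 1"
proof -
  have "sqrt (max 0 (4 - x\<^sup>2)) \<le> sqrt 4" by (rule real_sqrt_le_mono) simp
  then have "sqrt (max 0 (4 - x\<^sup>2)) \<le> 2 * pi" using pi_gt3 by simp
  then show ?thesis unfolding semicircle_density_alt using pi_gt_zero by (simp add: divide_le_eq)
qed

lemma semicircle_density_eq_0: "2 \<le> \<bar>x\<bar> \<Longrightarrow> semicircle_density x = 0"
  using abs_le_square_iff[of 2 x] unfolding semicircle_density_alt by simp

lemma integrable_semicircle_density: "semicircle_density integrable_on {a..b}"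
  by (rule integrable_continuous_interval[OF continuous_on_semicircle_density])

text \<open>Serves as a modulus of continuity of the semicircle distribution function.\<close>

lemma integral_semicircle_density_le:
  assumes "a \<le> b"
  shows "integral {a..b} semicircle_density \<le> b - a"
proof -
  have "integral {a..b} semicircle_density \<le> integral {a..b} (\<lambda>_. 1)"
    by (rule integral_le) (auto intro: integrable_semicircle_density semicircle_density_le)
  then show ?thesis using assms by simp
qed

lemma integral_semicircle_density_outside:
  assumes "b \<le> -2 \<or> 2 \<le> a"
  shows "integral {a..b} semicircle_density = 0"
proof -
  have "integral {a..b} semicircle_density = integral {a..b} (\<lambda>_. 0)"
    by (rule integral_cong) (use assms in \<open>auto intro: semicircle_density_eq_0\<close>)
  then show ?thesis by simp
qed

lemma integral_semicircle_density_center: "integral {-2..2} semicircle_density = 1"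
proof -
  define H where "H x = (x * sqrt (4 - x\<^sup>2) / 2 + 2 * arcsin (x / 2)) / (2 * pi)" for x :: real
  have "(semicircle_density has_integral (H 2 - H (-2))) {-2..2}"
  \<comment> \<open>The derivative rules for the square root and \<open>arcsin\<close> fail at the
    end points -2 and 2, where only continuity of \<open>H\<close> is available.\<close>
  proof (rule fundamental_theorem_of_calculus_interior)
    show "continuous_on {-2..2} H"
      unfolding H_def by (intro continuous_intros) auto
    fix x :: real assume "x \<in> {-2<..<2}"
    then have x: "-2 < x" "x < 2" by auto
    then have "x\<^sup>2 < 4" using abs_le_square_iff[of 2 x] by (simp add: abs_if split: if_splits)
    define r where "r = sqrt (4 - x\<^sup>2)"
    have r: "r > 0" "r\<^sup>2 = 4 - x\<^sup>2" using \<open>x\<^sup>2 < 4\<close> by (auto simp: r_def)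
    have r2: "sqrt (1 - (x / 2)\<^sup>2) = r / 2"
      by (rule real_sqrt_unique) (use r in \<open>auto simp: power_divide field_simps\<close>)
    have "((\<lambda>x. x * sqrt (4 - x\<^sup>2) / 2) has_real_derivative (r + x * (- x / r)) / 2) (at x)"
      using \<open>x\<^sup>2 < 4\<close> by (auto intro!: derivative_eq_intros simp: r_def field_simps)
    moreover have "((\<lambda>x. 2 * arcsin (x / 2)) has_real_derivative (2 * (inverse (r / 2) * (1 / 2)))) (at x)"
      using x by (auto intro!: derivative_eq_intros simp: r2)
    ultimately have "(H has_real_derivative ((r + x * (- x / r)) / 2 + 2 * (inverse (r / 2) * (1 / 2))) / (2 * pi)) (at x)"
      unfolding H_def by (rule DERIV_cdivide[OF DERIV_add])
    moreover have "((r + x * (- x / r)) / 2 + 2 * (inverse (r / 2) * (1 / 2))) = r"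
      using r by (simp add: field_simps power2_eq_square)
    moreover have "semicircle_density x = r / (2 * pi)"
      using x by (simp add: semicircle_density_def r_def abs_if)
    ultimately show "(H has_vector_derivative semicircle_density x) (at x)"
      by (simp add: has_real_derivative_iff_has_vector_derivative)
  qed simp
  then show ?thesis by (simp add: integral_unique H_def field_simps)
qed

lemma integral_semicircle_density_total:
  assumes "a \<le> -2" "2 \<le> b"
  shows "integral {a..b} semicircle_density = 1"
proof -
  have "integral {a..b} semicircle_density = integral {a..-2} semicircle_density + integral {-2..b} semicircle_density"
    using assms by (intro Henstock_Kurzweil_Integration.integral_combine[symmetric] integrable_semicircle_density) auto
  also have "integral {-2..b} semicircle_density = integral {-2..2} semicircle_density + integral {2..b} semicircle_density"
    using assms by (intro Henstock_Kurzweil_Integration.integral_combine[symmetric] integrable_semicircle_density) auto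
  finally show ?thesis
    by (simp add: integral_semicircle_density_outside integral_semicircle_density_center)
qed

text \<open>There is no mass to the left of -2, so any \<open>a\<close> below serves as lower limit.
  This links the measure-theoretic distribution function to integrals over compact
  intervals.\<close>

lemma semicircle_cdf_eq_integral:
  assumes "a \<le> -2" "a \<le> x"
  shows "semicircle_cdf x = integral {a..x} semicircle_density"
proof -
  have [measurable]: "semicircle_density \<in> borel_measurable borel"
    by (rule borel_measurable_continuous_onI[OF continuous_on_semicircle_density])
  have "emeasure (density lborel (\<lambda>x. ennreal (semicircle_density x))) {..x} =
      (\<integral>\<^sup>+ y. ennreal (semicircle_density y) * indicator {..x} y \<partial>lborel)"
    by (subst emeasure_density) auto
  also have "\<dots> = (\<integral>\<^sup>+ y. ennreal (if y \<in> {a..x} then semicircle_density y else 0) \<partial>lborel)"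
    by (intro nn_integral_cong)
      (use assms in \<open>auto simp: indicator_def semicircle_density_def abs_if split: if_splits\<close>)
  also have "\<dots> = ennreal (integral {a..x} semicircle_density)"
  proof (rule nn_integral_has_integral_lborel)
    show "((\<lambda>y. if y \<in> {a..x} then semicircle_density y else 0) has_integral integral {a..x} semicircle_density) UNIV"
      unfolding has_integral_restrict_UNIV using integrable_semicircle_density by (rule integrable_integral)
  qed (auto simp: semicircle_density_nonneg)
  finally show ?thesis
    unfolding semicircle_cdf_def cdf_def measure_def
    by (simp add: integral_nonneg[OF integrable_semicircle_density] semicircle_density_nonneg)
qed

definition stieltjes_defect :: "complex \<Rightarrow> complex \<Rightarrow> complex"
  where "stieltjes_defect z s = 1 + z * s + s\<^sup>2"

text \<open>The defect factors, up to an error of size \<open>Im z\<close>, through the two boundary values of the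
  semicircle transform on the real line.\<close>

lemma semicircle_density_le_Im:
  assumes z: "Im z > 0" and s: "Im s \<ge> 0"
  defines "d \<equiv> cmod (stieltjes_defect z s)"
  shows "pi * semicircle_density (Re z) \<le> Im s + sqrt (d + Im z * (1 + cmod z + d))"
proof (cases "\<bar>Re z\<bar> \<le> 2")
  case False
  then have "semicircle_density (Re z) = 0" by (simp add: semicircle_density_def)
  then show ?thesis using s z by (simp add: d_def)
next
  case True
  define x where "x = Re z"
  have x: "x\<^sup>2 \<le> 4" using True abs_le_square_iff[of x 2] by (simp add: x_def)
  define r where "r = sqrt (4 - x\<^sup>2)"
  have r: "r \<ge> 0" "r\<^sup>2 = 4 - x\<^sup>2" using x by (auto simp: r_def)
  \<comment> \<open>\<open>m\<close> and \<open>cnj m\<close> are the roots of 1 + x t + t^2 at the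
    real point x = Re z; the imaginary part of \<open>m\<close> is \<pi> times the density.\<close>
  define m where "m = Complex (- x / 2) (r / 2)"
  have m1: "m + cnj m = - x" unfolding m_def by (simp add: complex_eq_iff)
  have m2: "m * cnj m = 1"
    unfolding m_def using r(2) by (simp add: complex_eq_iff power2_eq_square field_simps)
  have "(s - m) * (s - cnj m) = s\<^sup>2 - s * (m + cnj m) + m * cnj m"
    by (simp add: algebra_simps power2_eq_square)
  also have "\<dots> = stieltjes_defect z s - \<i> * Im z * s"
    unfolding m1 m2 stieltjes_defect_def x_def
    by (subst (2) complex_eq[of z]) (simp add: algebra_simps)
  finally have prod: "cmod (s - m) * cmod (s - cnj m) = cmod (stieltjes_defect z s - \<i> * Im z * s)"
    by (metis norm_mult)
  \<comment> \<open>An a priori bound from the quadratic: if \<open>cmod s\<close> exceeds 1,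
    dividing the equation for s^2 by \<open>cmod s\<close> gives it.\<close>
  have "cmod s \<le> 1 + cmod z + d"
  proof (cases "cmod s \<le> 1")
    case True
    then show ?thesis by (simp add: d_def add_increasing2)
  next
    case False
    have "s\<^sup>2 = stieltjes_defect z s - 1 - z * s" by (simp add: stieltjes_defect_def)
    then have "(cmod s)\<^sup>2 = cmod (stieltjes_defect z s - 1 - z * s)" by (metis norm_power)
    also have "\<dots> \<le> d + 1 + cmod z * cmod s"
      unfolding d_def by (metis norm_triangle_le_diff norm_triangle_ineq4 norm_mult norm_one add_right_mono order_trans)
    also have "\<dots> \<le> (d + 1 + cmod z) * cmod s"
      using False mult_left_mono[of 1 "cmod s" "d + 1"] by (simp add: algebra_simps d_def)
    finally have "cmod s * cmod s \<le> (d + 1 + cmod z) * cmod s" by (simp add: power2_eq_square)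
    then show ?thesis using mult_right_le_imp_le[of "cmod s" "cmod s" "d + 1 + cmod z"] False
      by (cases "s = 0") (auto simp: algebra_simps)
  qed
  then have "Im z * cmod s \<le> Im z * (1 + cmod z + d)" using z by simp
  then have "cmod (stieltjes_defect z s - \<i> * Im z * s) \<le> d + Im z * (1 + cmod z + d)"
    using z order_trans[OF norm_triangle_ineq4[of "stieltjes_defect z s" "\<i> * Im z * s"]]
    unfolding norm_mult by (simp add: d_def)
  with prod have prod_le: "cmod (s - m) * cmod (s - cnj m) \<le> d + Im z * (1 + cmod z + d)" by simp
  define e where "e = sqrt (d + Im z * (1 + cmod z + d))"
  have e: "0 \<le> e" "e * e = d + Im z * (1 + cmod z + d)"
    using z by (auto simp: e_def d_def)
  \<comment> \<open>The product of the two distances is at most e^2, so one of them is at most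
    e.\<close>
  have "cmod (s - m) \<le> e \<or> cmod (s - cnj m) \<le> e"
  proof (rule ccontr)
    assume "\<not> ?thesis"
    then have "e * e < cmod (s - m) * cmod (s - cnj m)"
      using e(1) by (intro mult_strict_mono') auto
    then show False using prod_le e by simp
  qed
  then have "r / 2 \<le> Im s + e"
  proof
    assume "cmod (s - m) \<le> e"
    then have "\<bar>Im (s - m)\<bar> \<le> e" using abs_Im_le_cmod order_trans by blast
    then show ?thesis by (simp add: m_def)
  next
    \<comment> \<open>Here s is near the lower root, so \<open>Im s + r / 2\<close> is at most e; as
      \<open>Im s\<close> is nonnegative, \<open>r / 2\<close> alone is at most e.\<close>
    assume "cmod (s - cnj m) \<le> e"
    then have "\<bar>Im (s - cnj m)\<bar> \<le> e" using abs_Im_le_cmod order_trans by blast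
    then show ?thesis using s r(1) by (simp add: m_def)
  qed
  moreover have "pi * semicircle_density (Re z) = r / 2"
    using True by (simp add: semicircle_density_def r_def x_def)
  ultimately show ?thesis by (simp add: e_def)
qed

section \<open>Convergence from the self-consistent equation\<close>

definition stieltjes :: "nat \<Rightarrow> (nat \<Rightarrow> real) \<Rightarrow> complex \<Rightarrow> complex"
  where "stieltjes n u z = (\<Sum>i<n. 1 / (complex_of_real (u i) - z)) / of_nat n"

section \<open>Smoothing by the Cauchy kernel\<close>

lemma has_integral_Im_cauchy_kernel:
  fixes l :: real
  assumes "a \<le> b" "\<eta> > 0"
  shows "((\<lambda>x. Im (1 / (complex_of_real l - Complex x \<eta>))) has_integral
    (arctan ((b - l) / \<eta>) - arctan ((a - l) / \<eta>))) {a..b}"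
proof (rule fundamental_theorem_of_calculus[OF assms(1)])
  fix x assume "x \<in> {a..b}"
  have "((\<lambda>x. arctan ((x - l) / \<eta>)) has_real_derivative inverse (1 + ((x - l) / \<eta>)\<^sup>2) * (1 / \<eta>)) (at x)"
    using assms by (auto intro!: derivative_eq_intros)
  moreover have "inverse (1 + ((x - l) / \<eta>)\<^sup>2) * (1 / \<eta>) = Im (1 / (complex_of_real l - Complex x \<eta>))"
  proof -
    have "Im (1 / (complex_of_real l - Complex x \<eta>)) = \<eta> / ((l - x)\<^sup>2 + \<eta>\<^sup>2)"
      by (simp add: Im_divide)
    moreover have "1 + ((x - l) / \<eta>)\<^sup>2 = ((l - x)\<^sup>2 + \<eta>\<^sup>2) / \<eta>\<^sup>2"
      using assms(2) by (simp add: power_divide field_simps power2_commute[of x l])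
    ultimately show ?thesis
      using assms(2) by (simp add: field_simps power2_eq_square)
  qed
  ultimately show "((\<lambda>x. arctan ((x - l) / \<eta>)) has_vector_derivative Im (1 / (complex_of_real l - Complex x \<eta>))) (at x within {a..b})"
    by (auto simp: has_real_derivative_iff_has_vector_derivative intro: has_vector_derivative_at_within)
qed

text \<open>For positive x, arctan x = \<pi> / 2 - arctan (1 / x), and arctan t \<le> t.\<close>

lemma arctan_ge_inverse: "x > 0 \<Longrightarrow> pi / 2 - 1 / x \<le> arctan x"
  using arctan_inverse[of x] arctan_le_self[of "inverse x"] by (simp add: inverse_eq_divide)

text \<open>The kernel has total mass \<pi>. If \<open>l\<close> is farther than \<kappa> from the
  interval, both arguments have the same sign and exceed \<kappa> / \<eta> in modulus, so both
  arctangents lie within \<eta> / \<kappa> of the same limit.\<close>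

lemma arctan_window_le:
  fixes l :: real
  assumes "\<eta> > 0" "\<kappa> > 0"
  shows "arctan ((b - l) / \<eta>) - arctan ((a - l) / \<eta>) \<le> pi * of_bool (l \<in> {a - \<kappa>..b + \<kappa>}) + \<eta> / \<kappa>"
proof -
  note A = arctan_lbound[of "(a - l) / \<eta>"] arctan_ubound[of "(b - l) / \<eta>"]
  have k: "pi / 2 - \<eta> / \<kappa> \<le> arctan (\<kappa> / \<eta>)"
    using arctan_ge_inverse[of "\<kappa> / \<eta>"] assms by simp
  consider "l \<in> {a - \<kappa>..b + \<kappa>}" | "l < a - \<kappa>" | "l > b + \<kappa>" by fastforce
  then show ?thesis
  proof cases
    case 1
    then show ?thesis using A divide_pos_pos[OF assms] by simp
  next
    case 2
    then have "arctan (\<kappa> / \<eta>) \<le> arctan ((a - l) / \<eta>)"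
      using assms by (intro arctan_le_iff[THEN iffD2] divide_right_mono) auto
    then show ?thesis using A k 2 by simp
  next
    case 3
    then have "arctan ((b - l) / \<eta>) \<le> arctan (- (\<kappa> / \<eta>))"
      using assms unfolding minus_divide_left by (intro arctan_le_iff[THEN iffD2] divide_right_mono) auto
    then show ?thesis using A k 3 by (simp add: arctan_minus)
  qed
qed

lemma Im_stieltjes_nonneg:
  assumes "Im z > 0"
  shows "Im (stieltjes n u z) \<ge> 0"
  unfolding stieltjes_def Im_divide_of_nat Im_sum
  by (intro divide_nonneg_nonneg sum_nonneg) (use assms in \<open>auto simp: Im_divide intro!: divide_nonneg_nonneg\<close>)

text \<open>Integrate the pointwise bound over the interval: each eigenvalue in the widened window
  contributes at most \<pi>, each other one only its kernel tail. After division by \<pi> the error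
  terms are enlarged by dropping their factor 1 / \<pi>.\<close>

lemma integral_semicircle_density_le_window:
  assumes ab: "a \<le> b" and \<eta>: "\<eta> > 0" and \<kappa>: "\<kappa> > 0" and n: "n > 0"
    and e: "\<And>x. x \<in> {a..b} \<Longrightarrow> pi * semicircle_density x \<le> Im (stieltjes n u (Complex x \<eta>)) + e" and e0: "e \<ge> 0"
  shows "integral {a..b} semicircle_density \<le>
    real (card {i. i < n \<and> u i \<in> {a - \<kappa>..b + \<kappa>}}) / real n + \<eta> / \<kappa> + e * (b - a)"
proof -
  let ?N = "real (card {i. i < n \<and> u i \<in> {a - \<kappa>..b + \<kappa>}})"
  let ?I = "(\<Sum>i<n. arctan ((b - u i) / \<eta>) - arctan ((a - u i) / \<eta>)) / real n + e * (b - a)"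
  have upper: "((\<lambda>x. Im (stieltjes n u (Complex x \<eta>)) + e) has_integral ?I) {a..b}"
    unfolding stieltjes_def Im_divide_of_nat Im_sum
  proof (rule has_integral_add)
    show "((\<lambda>x. (\<Sum>i<n. Im (1 / (complex_of_real (u i) - Complex x \<eta>))) / real n) has_integral
        (\<Sum>i<n. arctan ((b - u i) / \<eta>) - arctan ((a - u i) / \<eta>)) / real n) {a..b}"
      by (intro has_integral_divide has_integral_sum finite_lessThan has_integral_Im_cauchy_kernel ab \<eta>)
    show "((\<lambda>x. e) has_integral e * (b - a)) {a..b}"
      using has_integral_const_real[of e a b] ab unfolding content_real[OF ab] real_scaleR_def
      by (simp only: mult.commute[of e])
  qed
  have lower: "((\<lambda>x. pi * semicircle_density x) has_integral pi * integral {a..b} semicircle_density) {a..b}"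
    by (intro has_integral_mult_right integrable_integral integrable_semicircle_density)
  have "pi * integral {a..b} semicircle_density \<le> ?I"
    by (rule has_integral_le[OF lower upper e])
  also have "\<dots> \<le> (\<Sum>i<n. pi * of_bool (u i \<in> {a - \<kappa>..b + \<kappa>}) + \<eta> / \<kappa>) / real n + e * (b - a)"
    by (intro add_right_mono divide_right_mono sum_mono arctan_window_le \<eta> \<kappa>) simp
  also have "(\<Sum>i<n. pi * of_bool (u i \<in> {a - \<kappa>..b + \<kappa>}) + \<eta> / \<kappa>) = pi * ?N + n * (\<eta> / \<kappa>)"
  proof -
    have "(\<Sum>i<n. of_bool (u i \<in> {a - \<kappa>..b + \<kappa>})) = ?N"
      by (subst sum_of_bool_eq) (auto intro!: arg_cong[of _ _ card])
    then show ?thesis by (simp add: sum.distrib sum_distrib_left[symmetric])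
  qed
  also have "(pi * ?N + n * (\<eta> / \<kappa>)) / n = pi * (?N / n) + \<eta> / \<kappa>"
    using n by (simp add: add_divide_distrib)
  finally have *: "pi * integral {a..b} semicircle_density \<le> pi * (?N / n) + (\<eta> / \<kappa> + e * (b - a))"
    by simp
  define r where "r = \<eta> / \<kappa> + e * (b - a)"
  have "integral {a..b} semicircle_density \<le> ?N / n + r / pi"
    using * pi_gt_zero unfolding r_def[symmetric] by (simp add: field_simps)
  moreover have "0 \<le> r"
    unfolding r_def using \<eta> \<kappa> ab e0 by simp
  then have "r / pi \<le> r" using pi_gt3 by (simp add: divide_le_eq mult_le_cancel_left1)
  ultimately show ?thesis unfolding r_def by linarith
qed

lemma cmod_cauchy_kernel_le:
  assumes "Im z > 0"
  shows "cmod (1 / (complex_of_real l - z)) \<le> 1 / Im z"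
proof -
  have "Im z \<le> cmod (complex_of_real l - z)"
    using abs_Im_le_cmod[of "complex_of_real l - z"] assms by simp
  then show ?thesis using assms by (simp add: norm_divide frac_le)
qed

lemma cmod_mean_le:
  fixes f :: "nat \<Rightarrow> complex"
  assumes "\<And>i. i < n \<Longrightarrow> cmod (f i) \<le> c" "c \<ge> 0"
  shows "cmod ((\<Sum>i<n. f i) / of_nat n) \<le> c"
proof (cases "n = 0")
  case False
  have "cmod (\<Sum>i<n. f i) \<le> (\<Sum>i<n. c)"
    by (rule sum_norm_le) (use assms in auto)
  then show ?thesis using False by (simp add: norm_divide divide_le_eq mult.commute)
qed (use assms in simp)

lemma cmod_stieltjes_le:
  assumes "Im z > 0"
  shows "cmod (stieltjes n u z) \<le> 1 / Im z"
  unfolding stieltjes_def by (rule cmod_mean_le) (use cmod_cauchy_kernel_le[OF assms] assms in auto)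

lemma cmod_stieltjes_diff_le:
  assumes "Im z = \<eta>" "Im w = \<eta>" "\<eta> > 0"
  shows "cmod (stieltjes n u z - stieltjes n u w) \<le> cmod (z - w) / \<eta>\<^sup>2"
proof -
  have "stieltjes n u z - stieltjes n u w =
      (\<Sum>i<n. 1 / (complex_of_real (u i) - z) - 1 / (complex_of_real (u i) - w)) / of_nat n"
    by (simp add: stieltjes_def sum_subtractf diff_divide_distrib)
  also have "cmod \<dots> \<le> cmod (z - w) / \<eta>\<^sup>2"
  proof (rule cmod_mean_le)
    fix i
    have nz: "complex_of_real (u i) - z \<noteq> 0" "complex_of_real (u i) - w \<noteq> 0"
      using assms by (auto simp: complex_eq_iff)
    then have "1 / (complex_of_real (u i) - z) - 1 / (complex_of_real (u i) - w) =
        (z - w) * (1 / (complex_of_real (u i) - z)) * (1 / (complex_of_real (u i) - w))"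
      by (simp add: field_simps)
    also have "cmod \<dots> \<le> cmod (z - w) * (1 / \<eta>) * (1 / \<eta>)"
      unfolding norm_mult
      using cmod_cauchy_kernel_le[of z "u i"] cmod_cauchy_kernel_le[of w "u i"] assms
      by (intro mult_mono) auto
    finally show "cmod (1 / (complex_of_real (u i) - z) - 1 / (complex_of_real (u i) - w)) \<le> cmod (z - w) / \<eta>\<^sup>2"
      by (simp add: power2_eq_square)
  qed simp
  finally show ?thesis .
qed

text \<open>The constant depends on the height and on \<open>cmod w\<close> but neither on
  \<open>n\<close> nor on \<open>u\<close>, so control at finitely many points of a horizontal
  segment extends to all of it.\<close>

lemma stieltjes_defect_lipschitz:
  assumes "Im z = \<eta>" "Im w = \<eta>" "\<eta> > 0"
  shows "cmod (stieltjes_defect z (stieltjes n u z) - stieltjes_defect w (stieltjes n u w))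
    \<le> cmod (z - w) * (1 / \<eta> + (cmod w + 2 / \<eta>) / \<eta>\<^sup>2)"
proof -
  define s t where "s = stieltjes n u z" and "t = stieltjes n u w"
  have s: "cmod s \<le> 1 / \<eta>" and t: "cmod t \<le> 1 / \<eta>"
    using cmod_stieltjes_le[of z n u] cmod_stieltjes_le[of w n u] assms by (auto simp: s_def t_def)
  have st: "cmod (s - t) \<le> cmod (z - w) / \<eta>\<^sup>2"
    unfolding s_def t_def by (rule cmod_stieltjes_diff_le[OF assms])
  have "stieltjes_defect z s - stieltjes_defect w t = (z - w) * s + (w + (s + t)) * (s - t)"
    by (simp add: stieltjes_defect_def algebra_simps power2_eq_square)
  also have "cmod \<dots> \<le> cmod (z - w) * cmod s + cmod (w + (s + t)) * cmod (s - t)"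
    using norm_triangle_ineq by (metis norm_mult)
  also have "\<dots> \<le> cmod (z - w) * (1 / \<eta>) + (cmod w + 2 / \<eta>) * (cmod (z - w) / \<eta>\<^sup>2)"
  proof (intro add_mono mult_mono s st)
    have "cmod (w + (s + t)) \<le> cmod w + (cmod s + cmod t)"
      by (meson norm_triangle_ineq norm_triangle_le order_trans add_left_mono)
    then show "cmod (w + (s + t)) \<le> cmod w + 2 / \<eta>" using s t by simp
  qed (use assms in auto)
  finally show ?thesis by (simp add: s_def t_def algebra_simps)
qed

section \<open>From countably many points to horizontal segments\<close>

lemma rational_net:
  fixes a b \<delta> :: real
  assumes "\<delta> > 0"
  obtains Q where "finite Q" "Q \<subseteq> \<rat>" "\<And>x. x \<in> {a..b} \<Longrightarrow> \<exists>q\<in>Q. \<bar>x - q\<bar> \<le> \<delta>"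
proof -
  obtain N :: nat where N: "N > 0" "1 / N < \<delta>"
    using assms nat_approx_posE[of \<delta>] by (metis of_nat_0_less_iff zero_less_Suc)
  \<comment> \<open>A grid of mesh 1 / N. Rational points are required because convergence is
    available only on a countable set.\<close>
  define Q where "Q = (\<lambda>j::int. of_int j / real N) ` {\<lfloor>a * N\<rfloor>..\<lfloor>b * N\<rfloor>}"
  have "\<exists>q\<in>Q. \<bar>x - q\<bar> \<le> \<delta>" if "x \<in> {a..b}" for x
  proof (intro bexI)
    have "of_int \<lfloor>x * N\<rfloor> \<le> x * N" "x * N < of_int \<lfloor>x * N\<rfloor> + 1" by linarith+
    then have "of_int \<lfloor>x * N\<rfloor> / N \<le> x" "x < of_int \<lfloor>x * N\<rfloor> / N + 1 / N"
      using N by (simp_all add: field_simps)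
    then show "\<bar>x - of_int \<lfloor>x * N\<rfloor> / N\<bar> \<le> \<delta>" using N by linarith
    show "of_int \<lfloor>x * N\<rfloor> / N \<in> Q"
      unfolding Q_def using that by (auto intro!: imageI floor_mono mult_right_mono)
  qed
  moreover have "finite Q" "Q \<subseteq> \<rat>" unfolding Q_def by auto
  ultimately show ?thesis using that by blast
qed

context
  fixes u :: "nat \<Rightarrow> nat \<Rightarrow> real"
  assumes defect: "\<And>x k. x \<in> \<rat> \<Longrightarrow> k > 0 \<Longrightarrow>
    (\<lambda>n. stieltjes_defect (Complex x (1 / real k)) (stieltjes n (u n) (Complex x (1 / real k)))) \<longlonglongrightarrow> 0"
begin

lemma eventually_defect_uniform:
  assumes k: "k > 0" and \<epsilon>: "\<epsilon> > 0"
  shows "\<forall>\<^sub>F n in sequentially. \<forall>x\<in>{a..b}.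
    cmod (stieltjes_defect (Complex x (1 / real k)) (stieltjes n (u n) (Complex x (1 / real k)))) \<le> \<epsilon>"
proof -
  define \<eta> where "\<eta> = 1 / real k"
  have \<eta>: "\<eta> > 0" using k by (simp add: \<eta>_def)
  define D where "D n x = stieltjes_defect (Complex x \<eta>) (stieltjes n (u n) (Complex x \<eta>))" for n x
  \<comment> \<open>Dominates the Lipschitz constant of the defect along the segment, where
    \<open>cmod (Complex x \<eta>)\<close> is at most \<bar>a\<bar> + \<bar>b\<bar> + \<eta>. A net
    of mesh \<epsilon> / (2 C) then costs \<epsilon> / 2.\<close>
  define C where "C = 1 / \<eta> + (\<bar>a\<bar> + \<bar>b\<bar> + \<eta> + 2 / \<eta>) / \<eta>\<^sup>2"
  have C: "C > 0" unfolding C_def using \<eta> by (intro add_pos_nonneg) auto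
  obtain Q where Q: "finite Q" "Q \<subseteq> \<rat>" "\<And>x. x \<in> {a..b} \<Longrightarrow> \<exists>q\<in>Q. \<bar>x - q\<bar> \<le> \<epsilon> / (2 * C)"
    using rational_net[of "\<epsilon> / (2 * C)" a b] \<epsilon> C by auto
  have "\<forall>\<^sub>F n in sequentially. \<forall>q\<in>Q. cmod (D n q) < \<epsilon> / 2"
  proof (rule eventually_ball_finite[OF Q(1)], rule ballI)
    fix q assume "q \<in> Q"
    then have "(\<lambda>n. D n q) \<longlonglongrightarrow> 0" unfolding D_def \<eta>_def using Q(2) k by (intro defect) auto
    from tendsto_norm_zero[OF this] show "\<forall>\<^sub>F n in sequentially. cmod (D n q) < \<epsilon> / 2"
      using \<epsilon> by (intro order_tendstoD(2)) auto
  qed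
  then show ?thesis
    unfolding \<eta>_def[symmetric] D_def[symmetric]
  proof eventually_elim
    case (elim n)
    show ?case
    proof
      fix x assume x: "x \<in> {a..b}"
      then obtain q where q: "q \<in> Q" "\<bar>x - q\<bar> \<le> \<epsilon> / (2 * C)" using Q(3) by blast
      have "Complex q \<eta> - Complex x \<eta> = of_real (q - x)" by (simp add: complex_eq_iff)
      then have d: "cmod (Complex q \<eta> - Complex x \<eta>) = \<bar>x - q\<bar>" by (simp del: of_real_diff)
      have "a \<le> x" "x \<le> b" using x by auto
      then have "\<bar>x\<bar> \<le> \<bar>a\<bar> + \<bar>b\<bar>" by linarith
      then have "cmod (Complex x \<eta>) \<le> \<bar>a\<bar> + \<bar>b\<bar> + \<eta>"
        using cmod_le[of "Complex x \<eta>"] \<eta> by simp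
      then have "1 / \<eta> + (cmod (Complex x \<eta>) + 2 / \<eta>) / \<eta>\<^sup>2 \<le> C"
        unfolding C_def using \<eta> by (intro add_left_mono divide_right_mono) auto
      then have step: "\<bar>x - q\<bar> * (1 / \<eta> + (cmod (Complex x \<eta>) + 2 / \<eta>) / \<eta>\<^sup>2) \<le> \<epsilon> / (2 * C) * C"
        using q(2) \<eta> C \<epsilon> by (intro mult_mono) auto
      have "cmod (D n q - D n x) \<le> \<bar>x - q\<bar> * (1 / \<eta> + (cmod (Complex x \<eta>) + 2 / \<eta>) / \<eta>\<^sup>2)"
        using stieltjes_defect_lipschitz[of "Complex q \<eta>" \<eta> "Complex x \<eta>" n "u n"] \<eta>
        unfolding d D_def by simp
      also note step
      also have "\<epsilon> / (2 * C) * C = \<epsilon> / 2" using C by simp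
      finally have "cmod (D n q - D n x) \<le> \<epsilon> / 2" .
      moreover have "cmod (D n q) < \<epsilon> / 2" using elim q(1) by blast
      ultimately show "cmod (D n x) \<le> \<epsilon>"
        using norm_triangle_ineq4[of "D n q" "D n q - D n x"] by simp
    qed
  qed
qed

text \<open>The order of choices matters: the height \<eta> = 1 / k is fixed so that all smoothing
  errors stay below \<epsilon>, and only afterwards is n taken large enough for the defect to be at
  most \<eta> on the whole segment.\<close>

lemma eventually_window_ge:
  assumes ab: "a \<le> b" and \<kappa>: "\<kappa> > 0" and \<epsilon>: "\<epsilon> > 0"
  shows "\<forall>\<^sub>F n in sequentially. integral {a..b} semicircle_density - \<epsilon>
    \<le> real (card {i. i < n \<and> u n i \<in> {a - \<kappa>..b + \<kappa>}}) / real n"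
proof -
  \<comment> \<open>With defect at most \<eta> and \<eta> \<le> 1, the quantity under the root in
    \<open>semicircle_density_le_Im\<close> is at most \<eta> + \<eta> (1 + (\<bar>a\<bar> +
    \<bar>b\<bar> + 1) + 1) = \<eta> K.\<close>
  define K where "K = \<bar>a\<bar> + \<bar>b\<bar> + 4"
  define h where "h k = 1 / real k / \<kappa> + sqrt (1 / real k * K) * (b - a)" for k
  have "h \<longlonglongrightarrow> 0 / \<kappa> + sqrt (0 * K) * (b - a)"
    unfolding h_def by (intro tendsto_intros lim_1_over_n) (use \<kappa> in auto)
  then have "\<forall>\<^sub>F k in sequentially. h k < \<epsilon>"
    using \<epsilon> by (intro order_tendstoD(2)) auto
  then have "\<forall>\<^sub>F k in sequentially. h k < \<epsilon> \<and> k > 0"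
    using eventually_gt_at_top[of 0] by eventually_elim auto
  then obtain k where k: "h k < \<epsilon>" "k > 0"
    using eventually_happens'[OF sequentially_bot] by blast
  define \<eta> where "\<eta> = 1 / real k"
  have \<eta>: "0 < \<eta>" "\<eta> \<le> 1" using k(2) by (auto simp: \<eta>_def)
  have "\<forall>\<^sub>F n in sequentially. \<forall>x\<in>{a..b}.
      cmod (stieltjes_defect (Complex x \<eta>) (stieltjes n (u n) (Complex x \<eta>))) \<le> \<eta>"
    using eventually_defect_uniform[OF k(2), of \<eta>] \<eta> unfolding \<eta>_def by simp
  then show ?thesis
    using eventually_gt_at_top[of 0]
  proof eventually_elim
    case (elim n)
    have "integral {a..b} semicircle_density \<le>
      real (card {i. i < n \<and> u n i \<in> {a - \<kappa>..b + \<kappa>}}) / real n + \<eta> / \<kappa> + sqrt (\<eta> * K) * (b - a)"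
    proof (rule integral_semicircle_density_le_window[OF ab \<eta>(1) \<kappa> elim(2)])
      fix x assume x: "x \<in> {a..b}"
      let ?s = "stieltjes n (u n) (Complex x \<eta>)"
      let ?d = "cmod (stieltjes_defect (Complex x \<eta>) ?s)"
      have d: "?d \<le> \<eta>" using elim(1) x by blast
      have "a \<le> x" "x \<le> b" using x by auto
      then have "\<bar>x\<bar> \<le> \<bar>a\<bar> + \<bar>b\<bar>" by linarith
      then have c: "cmod (Complex x \<eta>) \<le> \<bar>a\<bar> + \<bar>b\<bar> + 1"
        using cmod_le[of "Complex x \<eta>"] \<eta> by simp
      have "?d + \<eta> * (1 + cmod (Complex x \<eta>) + ?d) \<le> \<eta> + \<eta> * (1 + (\<bar>a\<bar> + \<bar>b\<bar> + 1) + 1)"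
        using d c \<eta> by (intro add_mono mult_left_mono) auto
      also have "\<dots> = \<eta> * K" by (simp add: K_def algebra_simps)
      finally have "sqrt (?d + \<eta> * (1 + cmod (Complex x \<eta>) + ?d)) \<le> sqrt (\<eta> * K)"
        by (rule real_sqrt_le_mono)
      moreover have "pi * semicircle_density x \<le> Im ?s + sqrt (?d + \<eta> * (1 + cmod (Complex x \<eta>) + ?d))"
        using semicircle_density_le_Im[of "Complex x \<eta>" ?s] Im_stieltjes_nonneg[of "Complex x \<eta>" n "u n"] \<eta>
        by simp
      ultimately show "pi * semicircle_density x \<le> Im ?s + sqrt (\<eta> * K)" by linarith
    qed (use \<eta> in \<open>simp add: K_def\<close>)
    then show ?case using k(1) unfolding h_def \<eta>_def by simp
  qed
qed

text \<open>Both estimates rest on lower bounds for windows: one to the left of x bounds the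
  distribution function from below, one to the right bounds its complement from below. Escape of
  mass to infinity is excluded along the way.\<close>

lemma empirical_cdf_tendsto_semicircle:
  "(\<lambda>n. real (card {i. i < n \<and> u n i \<le> x}) / real n) \<longlonglongrightarrow> semicircle_cdf x"
proof (rule LIMSEQ_I)
  let ?F = "\<lambda>n. real (card {i. i < n \<and> u n i \<le> x}) / real n"
  fix e :: real assume e: "e > 0"
  \<comment> \<open>The final errors are 2 \<kappa> below and 3 \<kappa> above; the cap 1 keeps the
    shifted points between \<open>a\<close> and \<open>b\<close>.\<close>
  define \<kappa> where "\<kappa> = min 1 (e / 4)"
  have \<kappa>: "\<kappa> > 0" "\<kappa> \<le> 1" "\<kappa> \<le> e / 4" using e by (auto simp: \<kappa>_def)
  \<comment> \<open>Chosen to enclose both the support of the density and the shifted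
    points.\<close>
  define a b where "a = - 3 - \<bar>x\<bar>" and "b = 3 + \<bar>x\<bar> + 2"
  have ab: "a \<le> x - \<kappa>" "x + 2 * \<kappa> \<le> b"
    using \<kappa> by (auto simp: a_def b_def)
  have "\<forall>\<^sub>F n in sequentially. \<bar>?F n - semicircle_cdf x\<bar> < e"
    using eventually_window_ge[OF ab(1) \<kappa>(1,1)] eventually_window_ge[OF ab(2) \<kappa>(1,1)]
      eventually_gt_at_top[of 0]
  proof eventually_elim
    case (elim n)
    have cdf: "semicircle_cdf y = integral {a..y} semicircle_density" if "a \<le> y" for y
      using that by (intro semicircle_cdf_eq_integral) (auto simp: a_def)
    have "semicircle_cdf x - \<kappa> \<le> integral {a..x - \<kappa>} semicircle_density"
    proof -
      have "semicircle_cdf x = integral {a..x - \<kappa>} semicircle_density + integral {x - \<kappa>..x} semicircle_density"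
        using \<kappa> by (subst cdf) (auto simp: a_def intro!: Henstock_Kurzweil_Integration.integral_combine[symmetric] integrable_semicircle_density)
      then show ?thesis using integral_semicircle_density_le[of "x - \<kappa>" x] \<kappa> by simp
    qed
    also have "\<dots> - \<kappa> \<le> ?F n"
    proof -
      have "real (card {i. i < n \<and> u n i \<in> {a - \<kappa>..x - \<kappa> + \<kappa>}}) \<le> real (card {i. i < n \<and> u n i \<le> x})"
        by (intro of_nat_mono card_mono) auto
      then have "real (card {i. i < n \<and> u n i \<in> {a - \<kappa>..x - \<kappa> + \<kappa>}}) / n \<le> ?F n"
        by (rule divide_right_mono) simp
      then show ?thesis using elim(1) by linarith
    qed
    finally have lower: "semicircle_cdf x - \<kappa> - \<kappa> \<le> ?F n" by simp
    have "1 = integral {a..x + 2 * \<kappa>} semicircle_density + integral {x + 2 * \<kappa>..b} semicircle_density"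
      using \<kappa> integral_semicircle_density_total[of a b]
      by (subst Henstock_Kurzweil_Integration.integral_combine) (auto simp: a_def b_def intro!: integrable_semicircle_density)
    moreover have "integral {a..x + 2 * \<kappa>} semicircle_density = semicircle_cdf x + integral {x..x + 2 * \<kappa>} semicircle_density"
      using \<kappa> by (subst cdf) (auto simp: a_def intro!: Henstock_Kurzweil_Integration.integral_combine[symmetric] integrable_semicircle_density)
    moreover have "integral {x..x + 2 * \<kappa>} semicircle_density \<le> 2 * \<kappa>"
      using integral_semicircle_density_le[of x "x + 2 * \<kappa>"] \<kappa> by simp
    ultimately have "1 - semicircle_cdf x - 2 * \<kappa> \<le> integral {x + 2 * \<kappa>..b} semicircle_density" by simp
    also have "\<dots> - \<kappa> \<le> 1 - ?F n"
    proof -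
      \<comment> \<open>The interval starts at x + 2 \<kappa>, so its window, widened by \<kappa>,
        still lies strictly to the right of x.\<close>
      have "card {i. i < n \<and> u n i \<in> {x + 2 * \<kappa> - \<kappa>..b + \<kappa>}} + card {i. i < n \<and> u n i \<le> x} =
          card ({i. i < n \<and> u n i \<in> {x + 2 * \<kappa> - \<kappa>..b + \<kappa>}} \<union> {i. i < n \<and> u n i \<le> x})"
        using \<kappa> by (intro card_Un_disjoint[symmetric]) auto
      also have "\<dots> \<le> card {..<n}" by (intro card_mono) auto
      finally have "real (card {i. i < n \<and> u n i \<in> {x + 2 * \<kappa> - \<kappa>..b + \<kappa>}}) \<le> real n - real (card {i. i < n \<and> u n i \<le> x})"
        by simp
      then have "real (card {i. i < n \<and> u n i \<in> {x + 2 * \<kappa> - \<kappa>..b + \<kappa>}}) / n \<le> 1 - ?F n"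
        using elim(3) by (simp add: field_simps)
      then show ?thesis using elim(2) \<kappa> by (simp add: b_def)
    qed
    finally have upper: "?F n \<le> semicircle_cdf x + 3 * \<kappa>" by simp
    show ?case using lower upper \<kappa> e by (simp add: abs_less_iff)
  qed
  then show "\<exists>no. \<forall>n\<ge>no. norm (?F n - semicircle_cdf x) < e"
    by (simp add: eventually_sequentially)
qed

end

section \<open>McDiarmid's inequality\<close>

lemma expectation_pair_pmf:
  fixes h :: "'a \<times> 'b \<Rightarrow> 'c::{banach, second_countable_topology}"
  assumes "finite (set_pmf p)" "finite (set_pmf q)"
  shows "measure_pmf.expectation (pair_pmf p q) h =
    measure_pmf.expectation p (\<lambda>x. measure_pmf.expectation q (\<lambda>y. h (x, y)))"
proof -
  have "measure_pmf.expectation (pair_pmf p q) h =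
      (\<Sum>x\<in>set_pmf p. pmf p x *\<^sub>R measure_pmf.expectation (q \<bind> (\<lambda>y. return_pmf (x, y))) h)"
    unfolding pair_pmf_def by (rule pmf_expectation_bind) (use assms in auto)
  also have "\<dots> = (\<Sum>x\<in>set_pmf p. pmf p x *\<^sub>R measure_pmf.expectation q (\<lambda>y. h (x, y)))"
    by (simp add: map_pmf_def[symmetric])
  also have "\<dots> = measure_pmf.expectation p (\<lambda>x. measure_pmf.expectation q (\<lambda>y. h (x, y)))"
    by (rule integral_measure_pmf[symmetric]) (use assms in auto)
  finally show ?thesis .
qed

lemma finite_set_Pi_pmf:
  assumes "finite A" "\<And>e. e \<in> A \<Longrightarrow> finite (set_pmf (P e))"
  shows "finite (set_pmf (Pi_pmf A d P))"
  using assms by (simp add: set_Pi_pmf finite_PiE_dflt)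

text \<open>All values lie within c of an arbitrary one, hence in an interval of length 2 c;
  Hoeffding's lemma then gives l^2 (2 c)^2 / 8.\<close>

lemma expectation_exp_le_Hoeffding:
  fixes f :: "'a \<Rightarrow> real"
  assumes fin: "finite (set_pmf q)" and l: "l > 0"
    and c: "\<And>y y'. y \<in> set_pmf q \<Longrightarrow> y' \<in> set_pmf q \<Longrightarrow> \<bar>f y - f y'\<bar> \<le> c"
  shows "measure_pmf.expectation q (\<lambda>y. exp (l * (f y - measure_pmf.expectation q f))) \<le> exp (l\<^sup>2 * c\<^sup>2 / 2)"
proof -
  obtain y0 where y0: "y0 \<in> set_pmf q" using set_pmf_not_empty[of q] by blast
  interpret interval_bounded_random_variable "measure_pmf q" f "f y0 - c" "f y0 + c"
  proof unfold_locales
    show "AE y in measure_pmf q. f y \<in> {f y0 - c..f y0 + c}"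
      using c[OF _ y0] by (intro AE_pmfI) (auto simp: abs_le_iff algebra_simps)
  qed auto
  have "ennreal (measure_pmf.expectation q (\<lambda>y. exp (l * (f y - measure_pmf.expectation q f)))) =
      (\<integral>\<^sup>+ y. ennreal (exp (l * (f y - measure_pmf.expectation q f))) \<partial>measure_pmf q)"
    by (rule nn_integral_eq_integral[symmetric]) (auto intro: integrable_measure_pmf_finite fin)
  also have "\<dots> \<le> ennreal (exp (l\<^sup>2 * ((f y0 + c) - (f y0 - c))\<^sup>2 / 8))"
    by (rule Hoeffdings_lemma_nn_integral[OF l])
  also have "((f y0 + c) - (f y0 - c))\<^sup>2 = 4 * c\<^sup>2" by (simp add: power2_eq_square)
  finally show ?thesis by (simp add: mult.commute)
qed

text \<open>Induction on the blocks. Averaging \<open>f\<close> over block \<open>k\<close> gives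
  \<open>g\<close>, which inherits the bounded differences in the other blocks; f - E f = (f - g) +
  (g - E g), where the first summand is handled by Hoeffding's lemma with the other blocks frozen
  and the second by induction.\<close>

lemma expectation_exp_bounded_differences:
  fixes f :: "('e \<Rightarrow> 'v) \<Rightarrow> real" and B :: "'j \<Rightarrow> 'e set" and d :: 'v
  assumes "finite J" and "l > 0" and "disjoint_family_on B J"
    and "\<And>j. j \<in> J \<Longrightarrow> finite (B j)"
    and "\<And>e. finite (set_pmf (P e))"
    and "\<And>j \<omega> \<omega>'. j \<in> J \<Longrightarrow> (\<And>e. e \<notin> B j \<Longrightarrow> \<omega> e = \<omega>' e) \<Longrightarrow> \<bar>f \<omega> - f \<omega>'\<bar> \<le> c"
  shows "measure_pmf.expectation (Pi_pmf (\<Union>j\<in>J. B j) d P)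
      (\<lambda>\<omega>. exp (l * (f \<omega> - measure_pmf.expectation (Pi_pmf (\<Union>j\<in>J. B j) d P) f)))
    \<le> exp (l\<^sup>2 * c\<^sup>2 / 2 * card J)"
  using assms(1,3,4,6)
proof (induction J arbitrary: f rule: finite_induct)
  case empty
  then show ?case by simp
next
  case (insert k J)
  define A where "A = (\<Union>j\<in>J. B j)"
  define mrg :: "('e \<Rightarrow> 'v) \<Rightarrow> ('e \<Rightarrow> 'v) \<Rightarrow> 'e \<Rightarrow> 'v"
    where "mrg x y = (\<lambda>e. if e \<in> A then x e else y e)" for x y
  define p1 where "p1 = Pi_pmf A d P"
  define p2 where "p2 = Pi_pmf (B k) d P"
  have fA: "finite A" "finite (B k)" using insert by (auto simp: A_def)
  have "B j \<inter> B k = {}" if "j \<in> J" for j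
    using disjoint_family_onD[OF insert.prems(1), of j k] that insert.hyps(2) by auto
  then have dis: "A \<inter> B k = {}" by (auto simp: A_def)
  have fin: "finite (set_pmf p1)" "finite (set_pmf p2)"
    unfolding p1_def p2_def by (auto intro!: finite_set_Pi_pmf fA assms(5))
  have int1: "integrable (measure_pmf p1) h" and int2: "integrable (measure_pmf p2) h" for h :: "('e \<Rightarrow> 'v) \<Rightarrow> real"
    using fin by (auto intro: integrable_measure_pmf_finite)
  have "(\<Union>j\<in>insert k J. B j) = A \<union> B k" by (auto simp: A_def)
  then have p: "Pi_pmf (\<Union>j\<in>insert k J. B j) d P = map_pmf (\<lambda>(x, y). mrg x y) (pair_pmf p1 p2)"
    using Pi_pmf_union[OF fA dis, of d P] by (simp add: p1_def p2_def mrg_def[abs_def])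
  have ex: "measure_pmf.expectation (Pi_pmf (\<Union>j\<in>insert k J. B j) d P) h =
      measure_pmf.expectation p1 (\<lambda>x. measure_pmf.expectation p2 (\<lambda>y. h (mrg x y)))" for h :: "('e \<Rightarrow> 'v) \<Rightarrow> real"
    unfolding p by (simp add: expectation_pair_pmf[OF fin])
  define g where "g x = measure_pmf.expectation p2 (\<lambda>y. f (mrg x y))" for x
  let ?m = "measure_pmf.expectation p1 g"
  have IH: "measure_pmf.expectation p1 (\<lambda>x. exp (l * (g x - ?m))) \<le> exp (l\<^sup>2 * c\<^sup>2 / 2 * card J)"
    unfolding p1_def A_def
  proof (rule insert.IH)
    fix j and \<omega> \<omega>' :: "'e \<Rightarrow> 'v" assume j: "j \<in> J" "\<And>e. e \<notin> B j \<Longrightarrow> \<omega> e = \<omega>' e"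
    have "\<bar>f (mrg \<omega> y) - f (mrg \<omega>' y)\<bar> \<le> c" for y
      by (rule insert.prems(3)[of j]) (use j in \<open>auto simp: mrg_def\<close>)
    then have "\<bar>measure_pmf.expectation p2 (\<lambda>y. f (mrg \<omega> y) - f (mrg \<omega>' y))\<bar> \<le> measure_pmf.expectation p2 (\<lambda>y. c)"
      by (intro order_trans[OF integral_abs_bound] integral_mono int2)
    then show "\<bar>g \<omega> - g \<omega>'\<bar> \<le> c"
      by (simp add: g_def Bochner_Integration.integral_diff int2)
  qed (use insert.prems in \<open>simp_all add: disjoint_family_on_def\<close>)
  have inner: "measure_pmf.expectation p2 (\<lambda>y. exp (l * (f (mrg x y) - g x))) \<le> exp (l\<^sup>2 * c\<^sup>2 / 2)" for x
    unfolding g_def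
  proof (rule expectation_exp_le_Hoeffding[OF fin(2) assms(2)])
    fix y y' assume "y \<in> set_pmf p2" "y' \<in> set_pmf p2"
    \<comment> \<open>Samples of \<open>p2\<close> take the default value \<open>d\<close> off the
      block, so two of them differ only inside it.\<close>
    then have "y e = y' e" if "e \<notin> B k" for e
      using set_Pi_pmf_subset[OF fA(2), of d P] that unfolding p2_def by auto
    then show "\<bar>f (mrg x y) - f (mrg x y')\<bar> \<le> c"
      by (intro insert.prems(3)[of k]) (auto simp: mrg_def)
  qed
  have "measure_pmf.expectation p1 (\<lambda>x. measure_pmf.expectation p2 (\<lambda>y. exp (l * (f (mrg x y) - ?m)))) =
      measure_pmf.expectation p1 (\<lambda>x. exp (l * (g x - ?m)) * measure_pmf.expectation p2 (\<lambda>y. exp (l * (f (mrg x y) - g x))))"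
    by (simp flip: Bochner_Integration.integral_mult_right_zero exp_add add: algebra_simps)
  also have "\<dots> \<le> measure_pmf.expectation p1 (\<lambda>x. exp (l * (g x - ?m)) * exp (l\<^sup>2 * c\<^sup>2 / 2))"
    by (intro integral_mono int1 mult_left_mono inner) simp
  also have "\<dots> = measure_pmf.expectation p1 (\<lambda>x. exp (l * (g x - ?m))) * exp (l\<^sup>2 * c\<^sup>2 / 2)"
    by simp
  also have "\<dots> \<le> exp (l\<^sup>2 * c\<^sup>2 / 2 * card J) * exp (l\<^sup>2 * c\<^sup>2 / 2)"
    by (intro mult_right_mono IH) simp
  also have "\<dots> = exp (l\<^sup>2 * c\<^sup>2 / 2 * card (insert k J))"
    using insert.hyps by (simp flip: exp_add add: algebra_simps add_divide_distrib)
  finally show ?case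
    unfolding ex g_def[symmetric] .
qed

theorem McDiarmid_upper_tail:
  fixes f :: "('e \<Rightarrow> 'v) \<Rightarrow> real" and B :: "'j \<Rightarrow> 'e set" and d :: 'v
  assumes "finite J" and "J \<noteq> {}" and "c > 0" and "t > 0" and "disjoint_family_on B J"
    and "\<And>j. j \<in> J \<Longrightarrow> finite (B j)"
    and fin: "\<And>e. finite (set_pmf (P e))"
    and "\<And>j \<omega> \<omega>'. j \<in> J \<Longrightarrow> (\<And>e. e \<notin> B j \<Longrightarrow> \<omega> e = \<omega>' e) \<Longrightarrow> \<bar>f \<omega> - f \<omega>'\<bar> \<le> c"
  defines "p \<equiv> Pi_pmf (\<Union>j\<in>J. B j) d P"
  shows "measure_pmf.prob p {\<omega>. f \<omega> - measure_pmf.expectation p f \<ge> t} \<le> exp (- (t\<^sup>2 / (2 * c\<^sup>2 * card J)))"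
proof -
  have m: "real (card J) > 0" using assms(1,2) by (simp add: card_gt_0_iff)
  \<comment> \<open>The minimiser of l^2 c^2 m / 2 - l t, where m is the number of blocks.\<close>
  define l where "l = t / (c\<^sup>2 * card J)"
  have l: "l > 0" using assms m by (simp add: l_def)
  have finp: "finite (set_pmf p)" unfolding p_def using assms by (intro finite_set_Pi_pmf) auto
  let ?X = "\<lambda>\<omega>. exp (l * (f \<omega> - measure_pmf.expectation p f))"
  have "{\<omega>. f \<omega> - measure_pmf.expectation p f \<ge> t} = {\<omega> \<in> space (measure_pmf p). exp (l * t) \<le> ?X \<omega>}"
    using l by auto
  then have "measure_pmf.prob p {\<omega>. f \<omega> - measure_pmf.expectation p f \<ge> t} \<le> measure_pmf.expectation p ?X / exp (l * t)"
    by (simp only:) (rule integral_Markov_inequality_measure[where A = "{}"],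
      auto intro: integrable_measure_pmf_finite finp)
  also have "\<dots> \<le> exp (l\<^sup>2 * c\<^sup>2 / 2 * card J) / exp (l * t)"
    unfolding p_def by (intro divide_right_mono expectation_exp_bounded_differences assms l) auto
  also have "\<dots> = exp (l\<^sup>2 * c\<^sup>2 / 2 * card J - l * t)"
    by (simp add: exp_diff)
  also have "l\<^sup>2 * c\<^sup>2 / 2 * card J - l * t = - (t\<^sup>2 / (2 * c\<^sup>2 * card J))"
    unfolding l_def using m assms(3) by (simp add: field_simps power2_eq_square)
  finally show ?thesis .
qed

text \<open>If the modulus is at least t, the real or the imaginary part deviates by at least t / 2.
  The two signs of each part give four one-sided tails, and t / 2 turns the constant 2 into
  8.\<close>

corollary McDiarmid_complex:
  fixes f :: "('e \<Rightarrow> 'v) \<Rightarrow> complex" and B :: "'j \<Rightarrow> 'e set" and d :: 'v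
  assumes "finite J" and "J \<noteq> {}" and "c > 0" and "t > 0" and "disjoint_family_on B J"
    and "\<And>j. j \<in> J \<Longrightarrow> finite (B j)"
    and fin: "\<And>e. finite (set_pmf (P e))"
    and diff: "\<And>j \<omega> \<omega>'. j \<in> J \<Longrightarrow> (\<And>e. e \<notin> B j \<Longrightarrow> \<omega> e = \<omega>' e) \<Longrightarrow> cmod (f \<omega> - f \<omega>') \<le> c"
  defines "p \<equiv> Pi_pmf (\<Union>j\<in>J. B j) d P"
  shows "measure_pmf.prob p {\<omega>. cmod (f \<omega> - measure_pmf.expectation p f) \<ge> t} \<le> 4 * exp (- (t\<^sup>2 / (8 * c\<^sup>2 * card J)))"
proof -
  have finp: "finite (set_pmf p)" unfolding p_def using assms by (intro finite_set_Pi_pmf) auto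
  let ?b = "exp (- ((t / 2)\<^sup>2 / (2 * c\<^sup>2 * card J)))"
  define S where "S h = {\<omega>. h \<omega> - measure_pmf.expectation p h \<ge> t / 2}" for h :: "('e \<Rightarrow> 'v) \<Rightarrow> real"
  have tail: "measure_pmf.prob p (S h) \<le> ?b" if "\<And>\<omega> \<omega>'. \<bar>h \<omega> - h \<omega>'\<bar> \<le> cmod (f \<omega> - f \<omega>')" for h
    unfolding p_def S_def
  proof (rule McDiarmid_upper_tail)
    fix j and \<omega> \<omega>' :: "'e \<Rightarrow> 'v" assume "j \<in> J" "\<And>e. e \<notin> B j \<Longrightarrow> \<omega> e = \<omega>' e"
    then show "\<bar>h \<omega> - h \<omega>'\<bar> \<le> c" using that[of \<omega> \<omega>'] diff[of j \<omega> \<omega>'] by fastforce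
  qed (use assms in auto)
  have [simp]: "integrable (measure_pmf p) f" using finp by (rule integrable_measure_pmf_finite)
  have "{\<omega>. cmod (f \<omega> - measure_pmf.expectation p f) \<ge> t} \<subseteq>
      (S (\<lambda>\<omega>. Re (f \<omega>)) \<union> S (\<lambda>\<omega>. - Re (f \<omega>))) \<union> (S (\<lambda>\<omega>. Im (f \<omega>)) \<union> S (\<lambda>\<omega>. - Im (f \<omega>)))" (is "_ \<subseteq> ?U")
  proof
    fix \<omega> assume "\<omega> \<in> {\<omega>. cmod (f \<omega> - measure_pmf.expectation p f) \<ge> t}"
    then have "t \<le> \<bar>Re (f \<omega>) - measure_pmf.expectation p (\<lambda>\<omega>. Re (f \<omega>))\<bar> + \<bar>Im (f \<omega>) - measure_pmf.expectation p (\<lambda>\<omega>. Im (f \<omega>))\<bar>"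
      using cmod_le[of "f \<omega> - measure_pmf.expectation p f"] by simp
    then show "\<omega> \<in> ?U" unfolding S_def by (simp add: abs_if split: if_splits) linarith+
  qed
  then have "measure_pmf.prob p {\<omega>. cmod (f \<omega> - measure_pmf.expectation p f) \<ge> t} \<le> measure_pmf.prob p ?U"
    by (rule measure_pmf.finite_measure_mono) simp
  also have "\<dots> \<le> (?b + ?b) + (?b + ?b)"
  proof (intro order_trans[OF measure_Un_le] add_mono tail)
    fix \<omega> \<omega>'
    show "\<bar>Re (f \<omega>) - Re (f \<omega>')\<bar> \<le> cmod (f \<omega> - f \<omega>')" "\<bar>Im (f \<omega>) - Im (f \<omega>')\<bar> \<le> cmod (f \<omega> - f \<omega>')"
      using abs_Re_le_cmod[of "f \<omega> - f \<omega>'"] abs_Im_le_cmod[of "f \<omega> - f \<omega>'"] by simp_all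
    then show "\<bar>- Re (f \<omega>) - - Re (f \<omega>')\<bar> \<le> cmod (f \<omega> - f \<omega>')" "\<bar>- Im (f \<omega>) - - Im (f \<omega>')\<bar> \<le> cmod (f \<omega> - f \<omega>')"
      by linarith+
  qed simp_all
  also have "\<dots> = 4 * exp (- (t\<^sup>2 / (8 * c\<^sup>2 * card J)))"
    by (simp add: power_divide)
  finally show ?thesis .
qed

section \<open>Expansion in a single edge\<close>

text \<open>Only coordinates above the diagonal are read, so every \<open>\<omega>\<close> yields a
  Hermitian matrix with zero diagonal, and independent coordinates yield independent entries up to
  mirroring.\<close>

definition wigner_fun :: "(nat \<times> nat \<Rightarrow> complex) \<Rightarrow> nat \<Rightarrow> nat \<Rightarrow> complex"
  where "wigner_fun \<omega> i j = (if i < j then \<omega> (i, j) else if j < i then cnj (\<omega> (j, i)) else 0)"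

definition edge :: "nat \<Rightarrow> nat \<Rightarrow> nat \<times> nat"
  where "edge i j = (min i j, max i j)"

text \<open>For Im z > 0 the chosen function is determined on indices below \<open>n\<close> by
  \<open>resolvent_unique\<close>; its values elsewhere are arbitrary and never read.\<close>

definition green :: "nat \<Rightarrow> (nat \<times> nat \<Rightarrow> complex) \<Rightarrow> complex \<Rightarrow> nat \<Rightarrow> nat \<Rightarrow> complex"
  where "green n \<omega> z = (SOME g. resolvent_on {..<n} (wigner_fun \<omega>) z g)"

definition green_trace :: "nat \<Rightarrow> complex \<Rightarrow> (nat \<times> nat \<Rightarrow> complex) \<Rightarrow> complex"
  where "green_trace n z \<omega> = (\<Sum>i<n. green n \<omega> z i i) / of_nat n"

lemma hermitian_wigner_fun: "hermitian_on I (wigner_fun \<omega>)"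
  unfolding hermitian_on_def wigner_fun_def by auto

lemma resolvent_green:
  assumes "Im z > 0"
  shows "resolvent_on {..<n} (wigner_fun \<omega>) z (green n \<omega> z)"
proof -
  let ?A = "mat n n (\<lambda>(i, j). wigner_fun \<omega> i j)"
  have eq: "?A $$ (i, j) = wigner_fun \<omega> i j" if "i \<in> {..<n}" "j \<in> {..<n}" for i j
    using that by simp
  have herm: "hermitian_on {..<n} (\<lambda>i j. ?A $$ (i, j))"
    unfolding hermitian_on_def
  proof (intro ballI)
    fix i j assume "i \<in> {..<n}" "j \<in> {..<n}"
    then show "?A $$ (j, i) = cnj (?A $$ (i, j))"
      by (simp add: wigner_fun_def)
  qed
  have "Im z \<noteq> 0" using assms by simp
  from ex_resolvent[OF mat_carrier herm this]
  have "\<exists>g. resolvent_on {..<n} (\<lambda>i j. ?A $$ (i, j)) z g"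
    by (rule ex_forward) (rule conjunct1)
  moreover have "resolvent_on {..<n} (\<lambda>i j. ?A $$ (i, j)) z g \<longleftrightarrow> resolvent_on {..<n} (wigner_fun \<omega>) z g" for g
    by (rule resolvent_on_cong) (rule eq)
  ultimately have "\<exists>g. resolvent_on {..<n} (wigner_fun \<omega>) z g" by simp
  then show ?thesis unfolding green_def by (rule someI_ex)
qed

lemma cmod_green_le:
  assumes "Im z > 0" "i < n" "j < n"
  shows "cmod (green n \<omega> z i j) \<le> 1 / Im z"
  using cmod_resolvent_le[OF finite_lessThan hermitian_wigner_fun resolvent_green[OF assms(1)] assms(1)] assms by simp

lemma sum_double_delta:
  fixes x y :: "nat \<Rightarrow> complex"
  assumes "i < n" "j < n"
  shows "(\<Sum>k<n. \<Sum>l<n. x k * (if k = i \<and> l = j then w else 0) * y l) = x i * w * y j"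
proof -
  have "(\<Sum>k<n. \<Sum>l<n. x k * (if k = i \<and> l = j then w else 0) * y l) = (\<Sum>k<n. if k = i then x k * w * y j else 0)"
  proof (rule sum.cong[OF refl])
    fix k
    have "(\<Sum>l<n. x k * (if k = i \<and> l = j then w else 0) * y l) =
        (\<Sum>l<n. if l = j then (if k = i then x k * w * y j else 0) else 0)"
      by (rule sum.cong) auto
    then show "(\<Sum>l<n. x k * (if k = i \<and> l = j then w else 0) * y l) = (if k = i then x k * w * y j else 0)"
      using assms by simp
  qed
  then show ?thesis using assms by simp
qed

section \<open>Removing one entry and its mirror image\<close>

context
  fixes n :: nat and z :: complex and \<omega> :: "nat \<times> nat \<Rightarrow> complex" and i j :: nat
    and w :: complex and g g0 \<eta>
  assumes z: "Im z > 0" and ij: "i < n" "j < n" "i \<noteq> j"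
  defines "\<eta> \<equiv> Im z" and "w \<equiv> wigner_fun \<omega> i j"
    and "g \<equiv> green n \<omega> z" and "g0 \<equiv> green n (fun_upd \<omega> (edge i j) 0) z"
begin

text \<open>The resolvent identity for a perturbation supported at \<open>(i, j)\<close> and
  \<open>(j, i)\<close>. Its use lies in \<open>g0\<close> not depending on the removed entry
  \<open>w\<close>.\<close>

lemma green_expand_edge:
  assumes "a < n" "b < n"
  shows "g a b = g0 a b - (w * g0 a i * g j b + cnj w * g0 a j * g i b)"
proof -
  let ?W = "wigner_fun \<omega>" and ?V = "wigner_fun (fun_upd \<omega> (edge i j) 0)"
  have "?W k l - ?V k l = (if k = i \<and> l = j then w else 0) + (if k = j \<and> l = i then cnj w else 0)" for k l
    using ij(3) unfolding w_def wigner_fun_def edge_def by (auto simp: min_def max_def)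
  then have "g0 a b - g a b = (\<Sum>k<n. \<Sum>l<n. g0 a k * (if k = i \<and> l = j then w else 0) * g l b) +
      (\<Sum>k<n. \<Sum>l<n. g0 a k * (if k = j \<and> l = i then cnj w else 0) * g l b)"
    using resolvent_identity[OF finite_lessThan resolvent_green[OF z] resolvent_green[OF z], of a n b
      "fun_upd \<omega> (edge i j) 0" \<omega>] assms
    unfolding g_def[symmetric] g0_def[symmetric]
    by (simp only: distrib_left distrib_right sum.distrib) simp
  then show ?thesis
    using ij by (simp only: sum_double_delta) (simp add: algebra_simps)
qed

lemma cmod_green_edge_diff_le:
  assumes "a < n" "b < n"
  shows "cmod (g a b - g0 a b) \<le> 2 * cmod w / \<eta>\<^sup>2"
proof -
  have gb: "cmod (g k l) \<le> 1 / \<eta>" "cmod (g0 k l) \<le> 1 / \<eta>" if "k < n" "l < n" for k l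
    using cmod_green_le[OF z that] unfolding g_def g0_def \<eta>_def by auto
  have \<eta>: "\<eta> > 0" using z by (simp add: \<eta>_def)
  have "g a b - g0 a b = - (w * g0 a i * g j b) - cnj w * g0 a j * g i b"
    using green_expand_edge[OF assms] by simp
  then have "cmod (g a b - g0 a b) \<le> cmod w * cmod (g0 a i) * cmod (g j b) + cmod w * cmod (g0 a j) * cmod (g i b)"
    using norm_triangle_ineq4[of "- (w * g0 a i * g j b)" "cnj w * g0 a j * g i b"] by (simp add: norm_mult)
  also have "\<dots> \<le> cmod w * (1 / \<eta>) * (1 / \<eta>) + cmod w * (1 / \<eta>) * (1 / \<eta>)"
    using assms ij \<eta> by (intro add_mono mult_mono gb) auto
  finally show ?thesis by (simp add: power2_eq_square)
qed

text \<open>Multiplying the expansion of \<open>g j i\<close> by \<open>w\<close> produces -|w|^2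
  \<open>g0 j j\<close> \<open>g i i\<close>, which the added product compensates up to O(\<delta>),
  and a term with w^2. The latter need not average out, so it is kept as an off-diagonal square for
  the Ward identity. The other two bounds serve to return from \<open>g0\<close> to
  \<open>g\<close>.\<close>

lemma green_edge_expansion_le:
  assumes \<delta>: "cmod w \<le> \<delta>" "\<delta> \<le> 1"
  shows "cmod (w * g j i - w * g0 j i + of_real ((cmod w)\<^sup>2) * (g0 i i * g0 j j))
      \<le> (cmod w)\<^sup>2 * (cmod (g0 j i))\<^sup>2 + 4 * \<delta> / \<eta> ^ 3 * (cmod w)\<^sup>2"
    and "cmod (g0 i i * g0 j j - g i i * g j j) \<le> 4 * \<delta> / \<eta> ^ 3"
    and "(cmod (g0 j i))\<^sup>2 \<le> 2 * (cmod (g j i))\<^sup>2 + 8 * \<delta> / \<eta> ^ 4"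
proof -
  define h where "h = cmod w"
  have h: "0 \<le> h" "h \<le> \<delta>" using \<delta> by (auto simp: h_def)
  have \<eta>: "\<eta> > 0" using z by (simp add: \<eta>_def)
  have gb: "cmod (g k l) \<le> 1 / \<eta>" "cmod (g0 k l) \<le> 1 / \<eta>" if "k < n" "l < n" for k l
    using cmod_green_le[OF z that] unfolding g_def g0_def \<eta>_def by auto
  have d: "cmod (g a b - g0 a b) \<le> 2 * \<delta> / \<eta>\<^sup>2" if "a < n" "b < n" for a b
    using cmod_green_edge_diff_le[OF that] h \<eta> divide_right_mono[of "2 * h" "2 * \<delta>" "\<eta>\<^sup>2"] unfolding h_def by simp
  have "w * g j i - w * g0 j i + of_real ((cmod w)\<^sup>2) * (g0 i i * g0 j j) =
      - (w\<^sup>2 * g0 j i * g j i) - of_real (h\<^sup>2) * (g0 j j * (g i i - g0 i i))"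
    unfolding h_def complex_norm_square
    by (subst (1) green_expand_edge[OF ij(2,1)]) (simp add: algebra_simps power2_eq_square)
  also have "cmod \<dots> \<le> h\<^sup>2 * cmod (g0 j i) * cmod (g j i) + h\<^sup>2 * (cmod (g0 j j) * cmod (g i i - g0 i i))"
    using norm_triangle_ineq4[of "- (w\<^sup>2 * g0 j i * g j i)" "of_real (h\<^sup>2) * (g0 j j * (g i i - g0 i i))"]
    by (simp add: norm_mult norm_power h_def)
  also have "\<dots> \<le> h\<^sup>2 * cmod (g0 j i) * (cmod (g0 j i) + 2 * \<delta> / \<eta>\<^sup>2) + h\<^sup>2 * ((1 / \<eta>) * (2 * \<delta> / \<eta>\<^sup>2))"
  proof (intro add_mono mult_left_mono mult_mono gb d)
    show "cmod (g j i) \<le> cmod (g0 j i) + 2 * \<delta> / \<eta>\<^sup>2"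
      using norm_triangle_sub[of "g j i" "g0 j i"] d[OF ij(2,1)] by simp
  qed (use ij \<eta> in auto)
  also have "h\<^sup>2 * cmod (g0 j i) * (cmod (g0 j i) + 2 * \<delta> / \<eta>\<^sup>2) =
      h\<^sup>2 * (cmod (g0 j i))\<^sup>2 + h\<^sup>2 * (cmod (g0 j i) * (2 * \<delta> / \<eta>\<^sup>2))"
    by (simp add: algebra_simps power2_eq_square)
  also have "h\<^sup>2 * (cmod (g0 j i) * (2 * \<delta> / \<eta>\<^sup>2)) \<le> h\<^sup>2 * ((1 / \<eta>) * (2 * \<delta> / \<eta>\<^sup>2))"
    using ij \<eta> h by (intro mult_left_mono mult_right_mono gb) auto
  finally show "cmod (w * g j i - w * g0 j i + of_real ((cmod w)\<^sup>2) * (g0 i i * g0 j j))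
      \<le> (cmod w)\<^sup>2 * (cmod (g0 j i))\<^sup>2 + 4 * \<delta> / \<eta> ^ 3 * (cmod w)\<^sup>2"
    using \<eta> by (simp add: h_def power2_eq_square power3_eq_cube field_simps)
  have "g0 i i * g0 j j - g i i * g j j = - ((g i i - g0 i i) * g0 j j) - g i i * (g j j - g0 j j)"
    by (simp add: algebra_simps)
  also have "cmod \<dots> \<le> cmod (g i i - g0 i i) * cmod (g0 j j) + cmod (g i i) * cmod (g j j - g0 j j)"
    using norm_triangle_ineq4[of "- ((g i i - g0 i i) * g0 j j)" "g i i * (g j j - g0 j j)"] by (simp add: norm_mult)
  also have "\<dots> \<le> (2 * \<delta> / \<eta>\<^sup>2) * (1 / \<eta>) + (1 / \<eta>) * (2 * \<delta> / \<eta>\<^sup>2)"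
    using ij \<eta> h by (intro add_mono mult_mono gb d) auto
  finally show "cmod (g0 i i * g0 j j - g i i * g j j) \<le> 4 * \<delta> / \<eta> ^ 3"
    using \<eta> by (simp add: power2_eq_square power3_eq_cube field_simps)
  have "(cmod (g0 j i))\<^sup>2 \<le> (cmod (g j i) + cmod (g j i - g0 j i))\<^sup>2"
    using norm_triangle_sub[of "g0 j i" "g j i"] by (intro power_mono) (auto simp: norm_minus_commute)
  also have "\<dots> \<le> 2 * (cmod (g j i))\<^sup>2 + 2 * (cmod (g j i - g0 j i))\<^sup>2"
    using zero_le_power2[of "cmod (g j i) - cmod (g j i - g0 j i)"] unfolding power2_diff power2_sum by argo
  also have "(cmod (g j i - g0 j i))\<^sup>2 \<le> (2 * \<delta> / \<eta>\<^sup>2)\<^sup>2"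
    using d[OF ij(2,1)] by (rule power_mono) simp
  also have "(2 * \<delta> / \<eta>\<^sup>2)\<^sup>2 = 4 / \<eta> ^ 4 * (\<delta> * \<delta>)"
    by (simp add: power_divide power_mult_distrib power2_eq_square power4_eq_xxxx)
  \<comment> \<open>Keeps every error linear in \<delta>.\<close>
  also have "\<delta> * \<delta> \<le> \<delta>" using h \<delta>(2) by (simp add: mult_left_le)
  finally show "(cmod (g0 j i))\<^sup>2 \<le> 2 * (cmod (g j i))\<^sup>2 + 8 * \<delta> / \<eta> ^ 4"
    using \<eta> by (simp add: mult_left_mono divide_right_mono)
qed

end

text \<open>Resetting coordinate \<open>e\<close> to the default value makes the second factor a
  function of the other coordinates, hence independent of the first.\<close>

lemma expectation_Pi_pmf_edge:
  fixes \<phi> :: "'v \<Rightarrow> 'b::{real_normed_field, banach, second_countable_topology}"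
  assumes "finite E" "e \<in> E" "\<And>e. finite (set_pmf (P e))"
  shows "measure_pmf.expectation (Pi_pmf E d P) (\<lambda>\<omega>. \<phi> (\<omega> e) * \<psi> (fun_upd \<omega> e d)) =
    measure_pmf.expectation (P e) \<phi> * measure_pmf.expectation (Pi_pmf E d P) (\<lambda>\<omega>. \<psi> (fun_upd \<omega> e d))"
proof -
  define p where "p = Pi_pmf (E - {e}) d P"
  have fin: "finite (set_pmf (P e))" "finite (set_pmf p)"
    unfolding p_def using assms by (auto intro!: finite_set_Pi_pmf)
  have E: "Pi_pmf E d P = map_pmf (\<lambda>(y, f). fun_upd f e y) (pair_pmf (P e) p)"
    using Pi_pmf_insert[of "E - {e}" e d P] assms by (simp add: p_def insert_absorb)
  show ?thesis
    unfolding E by (simp add: expectation_pair_pmf[OF fin])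
qed

section \<open>The expected defect and its concentration\<close>

lemma finite_possible_edges: "finite (possible_edges n)"
  by (rule finite_subset[of _ "{..<n} \<times> {..<n}"]) (auto simp: possible_edges_def)

text \<open>\<open>P\<close> is the law of an entry above the diagonal with the factor 1 / sqrt n
  already included, so that n \<sigma>2 is close to 1 in the application. Finite support makes every
  function integrable.\<close>

locale wigner_pmf =
  fixes n :: nat and P :: "complex pmf" and \<delta> \<sigma>2 :: real
  assumes finite_P: "finite (set_pmf P)"
    and mean_0: "measure_pmf.expectation P (\<lambda>x. x) = 0"
    and variance: "measure_pmf.expectation P (\<lambda>x. (cmod x)\<^sup>2) = \<sigma>2"
    and bounded: "\<And>x. x \<in> set_pmf P \<Longrightarrow> cmod x \<le> \<delta>"
    and delta_le_1: "\<delta> \<le> 1"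
    and n_pos: "n > 0"
begin

definition p :: "(nat \<times> nat \<Rightarrow> complex) pmf"
  where "p = Pi_pmf (possible_edges n) 0 (\<lambda>_. P)"

lemma finite_set_p: "finite (set_pmf p)"
  unfolding p_def by (intro finite_set_Pi_pmf finite_possible_edges finite_P)

lemma integrable_p [simp]:
  fixes f :: "(nat \<times> nat \<Rightarrow> complex) \<Rightarrow> 'b::{banach, second_countable_topology}"
  shows "integrable (measure_pmf p) f"
  by (rule integrable_measure_pmf_finite[OF finite_set_p])

abbreviation E :: "((nat \<times> nat \<Rightarrow> complex) \<Rightarrow> complex) \<Rightarrow> complex" where "E \<equiv> measure_pmf.expectation p"
abbreviation Er :: "((nat \<times> nat \<Rightarrow> complex) \<Rightarrow> real) \<Rightarrow> real" where "Er \<equiv> measure_pmf.expectation p"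

lemma Er_mono: "(\<And>\<omega>. \<omega> \<in> set_pmf p \<Longrightarrow> f \<omega> \<le> h \<omega>) \<Longrightarrow> Er f \<le> Er h"
  by (intro integral_mono_AE) (auto intro: AE_pmfI)

lemma cmod_E_le: "cmod (E f) \<le> Er (\<lambda>\<omega>. cmod (f \<omega>))"
  by (rule integral_norm_bound)

lemma delta_nonneg: "\<delta> \<ge> 0"
  using set_pmf_not_empty[of P] bounded norm_ge_zero order_trans by blast

lemma sigma2_nonneg: "\<sigma>2 \<ge> 0"
  unfolding variance[symmetric] by simp

lemma wigner_fun_edge:
  assumes "i \<noteq> j"
  shows "wigner_fun \<omega> i j = (if i < j then \<omega> (edge i j) else cnj (\<omega> (edge i j)))"
  using assms by (auto simp: wigner_fun_def edge_def)

lemma edge_possible: "i < n \<Longrightarrow> j < n \<Longrightarrow> i \<noteq> j \<Longrightarrow> edge i j \<in> possible_edges n"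
  by (auto simp: edge_def possible_edges_def)

lemma cmod_wigner_fun_le:
  assumes "\<omega> \<in> set_pmf p" "i < n" "j < n" "i \<noteq> j"
  shows "cmod (wigner_fun \<omega> i j) \<le> \<delta>"
proof -
  have "\<omega> (edge i j) \<in> set_pmf P"
    using assms(1) edge_possible[OF assms(2-4)]
    unfolding p_def set_Pi_pmf[OF finite_possible_edges] PiE_dflt_def mem_Collect_eq comp_def by blast
  then show ?thesis using bounded assms(4) by (simp add: wigner_fun_edge)
qed

lemma
  assumes "i < n" "j < n" "i \<noteq> j"
  shows E_wigner_times: "E (\<lambda>\<omega>. wigner_fun \<omega> i j * \<psi> (fun_upd \<omega> (edge i j) 0)) = 0"
    and E_square_times: "E (\<lambda>\<omega>. of_real ((cmod (wigner_fun \<omega> i j))\<^sup>2) * \<psi> (fun_upd \<omega> (edge i j) 0)) =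
      of_real \<sigma>2 * E (\<lambda>\<omega>. \<psi> (fun_upd \<omega> (edge i j) 0))"
    and Er_square_times: "Er (\<lambda>\<omega>. (cmod (wigner_fun \<omega> i j))\<^sup>2 * \<rho> (fun_upd \<omega> (edge i j) 0)) =
      \<sigma>2 * Er (\<lambda>\<omega>. \<rho> (fun_upd \<omega> (edge i j) 0))"
    and Er_square: "Er (\<lambda>\<omega>. (cmod (wigner_fun \<omega> i j))\<^sup>2) = \<sigma>2"
proof -
  note edge = expectation_Pi_pmf_edge[OF finite_possible_edges edge_possible[OF assms], where P = "\<lambda>_. P", OF finite_P]
  have "integrable (measure_pmf P) (\<lambda>x. x)" by (rule integrable_measure_pmf_finite[OF finite_P])
  then have "measure_pmf.expectation P (\<lambda>x. if i < j then x else cnj x) = 0"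
    using mean_0 by (cases "i < j") simp_all
  then show "E (\<lambda>\<omega>. wigner_fun \<omega> i j * \<psi> (fun_upd \<omega> (edge i j) 0)) = 0"
    using edge[of 0 "\<lambda>x. if i < j then x else cnj x" \<psi>] assms unfolding p_def[symmetric]
    by (simp only: wigner_fun_edge[OF assms(3)] mult_zero_left)
  have cm: "cmod (wigner_fun \<omega> i j) = cmod (\<omega> (edge i j))" for \<omega>
    using assms by (simp add: wigner_fun_edge)
  have "measure_pmf.expectation P (\<lambda>x. complex_of_real ((cmod x)\<^sup>2)) = of_real \<sigma>2"
    unfolding variance[symmetric] by (intro integral_of_real integrable_measure_pmf_finite finite_P)
  then show "E (\<lambda>\<omega>. of_real ((cmod (wigner_fun \<omega> i j))\<^sup>2) * \<psi> (fun_upd \<omega> (edge i j) 0)) =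
      of_real \<sigma>2 * E (\<lambda>\<omega>. \<psi> (fun_upd \<omega> (edge i j) 0))"
    using edge[of 0 "\<lambda>x. complex_of_real ((cmod x)\<^sup>2)" \<psi>] unfolding p_def[symmetric] cm by simp
  show sq: "Er (\<lambda>\<omega>. (cmod (wigner_fun \<omega> i j))\<^sup>2 * \<rho> (fun_upd \<omega> (edge i j) 0)) =
      \<sigma>2 * Er (\<lambda>\<omega>. \<rho> (fun_upd \<omega> (edge i j) 0))" for \<rho>
    using edge[of 0 "\<lambda>x. (cmod x)\<^sup>2" \<rho>] unfolding p_def[symmetric] cm variance by simp
  show "Er (\<lambda>\<omega>. (cmod (wigner_fun \<omega> i j))\<^sup>2) = \<sigma>2"
    using sq[of "\<lambda>_. 1"] by simp
qed

context
  fixes z :: complex and \<eta>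
  assumes z: "Im z > 0"
  defines "\<eta> \<equiv> Im z"
begin

lemma eta_pos: "\<eta> > 0" using z by (simp add: \<eta>_def)

abbreviation G :: "(nat \<times> nat \<Rightarrow> complex) \<Rightarrow> nat \<Rightarrow> nat \<Rightarrow> complex" where "G \<omega> \<equiv> green n \<omega> z"

text \<open>In expectation the linear term vanishes and |w|^2 becomes \<sigma>2. Of the errors, 8 /
  \<eta>^3 collects the remainder of the expansion and the replacement of the product of
  \<open>g0\<close> entries, 4 / \<eta>^3 each; 8 / \<eta>^4 comes from replacing the off-diagonal
  square.\<close>

lemma edge_expectation_le:
  assumes ij: "i < n" "j < n" "i \<noteq> j"
  shows "cmod (E (\<lambda>\<omega>. wigner_fun \<omega> i j * G \<omega> j i) + \<sigma>2 * E (\<lambda>\<omega>. G \<omega> i i * G \<omega> j j))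
    \<le> 2 * \<sigma>2 * Er (\<lambda>\<omega>. (cmod (G \<omega> j i))\<^sup>2) + \<sigma>2 * \<delta> * (8 / \<eta> ^ 3 + 8 / \<eta> ^ 4)"
proof -
  define K where "K = 4 * \<delta> / \<eta> ^ 3"
  let ?w = "\<lambda>\<omega>. wigner_fun \<omega> i j"
  let ?G0 = "\<lambda>\<omega>. green n (fun_upd \<omega> (edge i j) 0) z"
  note expand = green_edge_expansion_le[OF z ij cmod_wigner_fun_le[OF _ ij] delta_le_1, folded \<eta>_def, folded K_def]
  have eq: "E (\<lambda>\<omega>. ?w \<omega> * G \<omega> j i - ?w \<omega> * ?G0 \<omega> j i + of_real ((cmod (?w \<omega>))\<^sup>2) * (?G0 \<omega> i i * ?G0 \<omega> j j)) =
      E (\<lambda>\<omega>. ?w \<omega> * G \<omega> j i) + \<sigma>2 * E (\<lambda>\<omega>. ?G0 \<omega> i i * ?G0 \<omega> j j)"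
    using E_wigner_times[OF ij, of "\<lambda>\<omega>. green n \<omega> z j i"] E_square_times[OF ij, of "\<lambda>\<omega>. green n \<omega> z i i * green n \<omega> z j j"]
    by (simp add: Bochner_Integration.integral_add Bochner_Integration.integral_diff)
  have "cmod (E (\<lambda>\<omega>. ?w \<omega> * G \<omega> j i) + \<sigma>2 * E (\<lambda>\<omega>. ?G0 \<omega> i i * ?G0 \<omega> j j)) \<le>
      Er (\<lambda>\<omega>. (cmod (?w \<omega>))\<^sup>2 * (cmod (?G0 \<omega> j i))\<^sup>2 + K * (cmod (?w \<omega>))\<^sup>2)"
    unfolding eq[symmetric] by (rule order_trans[OF cmod_E_le Er_mono]) (rule expand(1))
  also have "\<dots> = \<sigma>2 * Er (\<lambda>\<omega>. (cmod (?G0 \<omega> j i))\<^sup>2) + K * \<sigma>2"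
    using Er_square_times[OF ij, of "\<lambda>\<omega>. (cmod (green n \<omega> z j i))\<^sup>2"] Er_square[OF ij]
    by (simp add: Bochner_Integration.integral_add)
  finally have A: "cmod (E (\<lambda>\<omega>. ?w \<omega> * G \<omega> j i) + \<sigma>2 * E (\<lambda>\<omega>. ?G0 \<omega> i i * ?G0 \<omega> j j)) \<le>
      \<sigma>2 * Er (\<lambda>\<omega>. (cmod (?G0 \<omega> j i))\<^sup>2) + K * \<sigma>2" .
  have "Er (\<lambda>\<omega>. (cmod (?G0 \<omega> j i))\<^sup>2) \<le> Er (\<lambda>\<omega>. 2 * (cmod (G \<omega> j i))\<^sup>2 + 8 * \<delta> / \<eta> ^ 4)"
    by (rule Er_mono) (rule expand(3))
  also have "\<dots> = 2 * Er (\<lambda>\<omega>. (cmod (G \<omega> j i))\<^sup>2) + 8 * \<delta> / \<eta> ^ 4"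
    by (simp add: Bochner_Integration.integral_add)
  finally have 1: "cmod (E (\<lambda>\<omega>. ?w \<omega> * G \<omega> j i) + \<sigma>2 * E (\<lambda>\<omega>. ?G0 \<omega> i i * ?G0 \<omega> j j)) \<le>
      \<sigma>2 * (2 * Er (\<lambda>\<omega>. (cmod (G \<omega> j i))\<^sup>2) + 8 * \<delta> / \<eta> ^ 4) + K * \<sigma>2"
    by (intro order_trans[OF A] add_right_mono mult_left_mono sigma2_nonneg)
  have "cmod (E (\<lambda>\<omega>. ?G0 \<omega> i i * ?G0 \<omega> j j) - E (\<lambda>\<omega>. G \<omega> i i * G \<omega> j j)) \<le> Er (\<lambda>\<omega>. K)"
    unfolding Bochner_Integration.integral_diff[OF integrable_p integrable_p, symmetric]
    by (rule order_trans[OF cmod_E_le Er_mono]) (rule expand(2))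
  then have "\<sigma>2 * cmod (E (\<lambda>\<omega>. ?G0 \<omega> i i * ?G0 \<omega> j j) - E (\<lambda>\<omega>. G \<omega> i i * G \<omega> j j)) \<le> \<sigma>2 * K"
    using sigma2_nonneg by (simp add: mult_left_mono)
  then have 2: "cmod (\<sigma>2 * E (\<lambda>\<omega>. ?G0 \<omega> i i * ?G0 \<omega> j j) - \<sigma>2 * E (\<lambda>\<omega>. G \<omega> i i * G \<omega> j j)) \<le> \<sigma>2 * K"
    unfolding right_diff_distrib[symmetric] norm_mult using sigma2_nonneg by simp
  have tri: "cmod (a + c) \<le> cmod (a + b) + cmod (b - c)" for a b c :: complex
    using norm_triangle_ineq4[of "a + b" "b - c"] by simp
  show ?thesis
    using order_trans[OF tri add_mono[OF 1 2]]
    by (simp add: K_def algebra_simps)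
qed

text \<open>The trace of W G = z G + 1, with \<sigma>2 times the off-diagonal products added and
  subtracted. In the double sum each summand is of the form estimated by
  \<open>edge_expectation_le\<close>; the rest corrects for n \<sigma>2 differing from 1 and for the
  missing diagonal.\<close>

lemma defect_mean_expand:
  "stieltjes_defect z (green_trace n z \<omega>) =
    (\<Sum>i<n. \<Sum>j\<in>{..<n} - {i}. wigner_fun \<omega> i j * G \<omega> j i + \<sigma>2 * (G \<omega> i i * G \<omega> j j)) / n
    + (1 - n * \<sigma>2) * (green_trace n z \<omega>)\<^sup>2 + \<sigma>2 / n * (\<Sum>i<n. (G \<omega> i i)\<^sup>2)"
proof -
  let ?T = "\<Sum>i<n. G \<omega> i i"
  have T: "of_nat n * green_trace n z \<omega> = ?T"
    using n_pos by (simp add: green_trace_def)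
  have "(\<Sum>j\<in>{..<n} - {i}. wigner_fun \<omega> i j * G \<omega> j i) = z * G \<omega> i i + 1" if "i < n" for i
  proof -
    have "(\<Sum>j\<in>{..<n} - {i}. wigner_fun \<omega> i j * G \<omega> j i) = (\<Sum>j<n. wigner_fun \<omega> i j * G \<omega> j i)"
      by (rule sum.mono_neutral_left) (auto simp: wigner_fun_def)
    then show ?thesis using resolvent_onD(1)[OF resolvent_green[OF z], of i n i \<omega>] that by simp
  qed
  then have 1: "(\<Sum>i<n. \<Sum>j\<in>{..<n} - {i}. wigner_fun \<omega> i j * G \<omega> j i) = z * ?T + of_nat n"
    by (simp add: sum.distrib sum_distrib_left)
  have "(\<Sum>j\<in>{..<n} - {i}. G \<omega> i i * G \<omega> j j) = G \<omega> i i * ?T - (G \<omega> i i)\<^sup>2" if "i < n" for i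
    using that by (simp add: sum_diff1 sum_distrib_left power2_eq_square)
  then have 2: "(\<Sum>i<n. \<Sum>j\<in>{..<n} - {i}. G \<omega> i i * G \<omega> j j) = ?T * ?T - (\<Sum>i<n. (G \<omega> i i)\<^sup>2)"
    by (simp add: sum_subtractf sum_distrib_right)
  have "(\<Sum>i<n. \<Sum>j\<in>{..<n} - {i}. wigner_fun \<omega> i j * G \<omega> j i + \<sigma>2 * (G \<omega> i i * G \<omega> j j)) =
      z * ?T + of_nat n + \<sigma>2 * (?T * ?T - (\<Sum>i<n. (G \<omega> i i)\<^sup>2))"
    unfolding 1[symmetric] 2[symmetric] by (simp add: sum.distrib sum_distrib_left)
  then show ?thesis
    unfolding stieltjes_defect_def T[symmetric] using n_pos
    by (simp add: field_simps power2_eq_square)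
qed

text \<open>By Ward the off-diagonal squares sum to at most 1 / \<eta>^2 per row, so after division
  by n they leave 2 \<sigma>2 / \<eta>^2; the diagonal correction adds another \<sigma>2 /
  \<eta>^2.\<close>

lemma expected_defect_le:
  "cmod (E (\<lambda>\<omega>. stieltjes_defect z (green_trace n z \<omega>))) \<le>
    \<bar>1 - n * \<sigma>2\<bar> / \<eta>\<^sup>2 + 3 * \<sigma>2 / \<eta>\<^sup>2 + n * \<sigma>2 * \<delta> * (8 / \<eta> ^ 3 + 8 / \<eta> ^ 4)"
proof -
  define C where "C = \<sigma>2 * \<delta> * (8 / \<eta> ^ 3 + 8 / \<eta> ^ 4)"
  have C: "C \<ge> 0" unfolding C_def using sigma2_nonneg delta_nonneg eta_pos by simp
  let ?S = "\<Sum>i<n. \<Sum>j\<in>{..<n} - {i}. E (\<lambda>\<omega>. wigner_fun \<omega> i j * G \<omega> j i) + \<sigma>2 * E (\<lambda>\<omega>. G \<omega> i i * G \<omega> j j)"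
  have eq: "E (\<lambda>\<omega>. stieltjes_defect z (green_trace n z \<omega>)) =
      ?S / n + (1 - n * \<sigma>2) * E (\<lambda>\<omega>. (green_trace n z \<omega>)\<^sup>2) + \<sigma>2 / n * (\<Sum>i<n. E (\<lambda>\<omega>. (G \<omega> i i)\<^sup>2))"
    unfolding defect_mean_expand
    by (simp add: Bochner_Integration.integral_add Bochner_Integration.integral_sum)
  have gb: "cmod (G \<omega> i j) \<le> 1 / \<eta>" if "i < n" "j < n" for \<omega> i j
    using cmod_green_le[OF z that] by (simp add: \<eta>_def)
  have "cmod ?S \<le> (\<Sum>i<n. \<Sum>j\<in>{..<n} - {i}. 2 * \<sigma>2 * Er (\<lambda>\<omega>. (cmod (G \<omega> j i))\<^sup>2) + C)"
    unfolding C_def by (intro sum_norm_le edge_expectation_le) auto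
  \<comment> \<open>The diagonal terms are put back so that Ward applies to complete rows.\<close>
  also have "\<dots> \<le> (\<Sum>i<n. \<Sum>j<n. 2 * \<sigma>2 * Er (\<lambda>\<omega>. (cmod (G \<omega> j i))\<^sup>2) + C)"
    by (intro sum_mono sum_mono2) (use C sigma2_nonneg in auto)
  also have "\<dots> = 2 * \<sigma>2 * (\<Sum>j<n. Er (\<lambda>\<omega>. \<Sum>i<n. (cmod (G \<omega> j i))\<^sup>2)) + n * n * C"
    by (subst sum.swap) (simp add: sum.distrib sum_distrib_left Bochner_Integration.integral_sum)
  also have "\<dots> \<le> 2 * \<sigma>2 * (\<Sum>j<n. Er (\<lambda>\<omega>. 1 / \<eta>\<^sup>2)) + n * n * C"
    unfolding \<eta>_def
    by (intro add_right_mono mult_left_mono sum_mono Er_mono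
        ward_row_le[OF finite_lessThan hermitian_wigner_fun resolvent_green[OF z] z]) (use sigma2_nonneg in auto)
  finally have "cmod ?S \<le> n * (2 * \<sigma>2 / \<eta>\<^sup>2 + n * C)"
    by (simp add: algebra_simps)
  then have 1: "cmod (?S / n) \<le> 2 * \<sigma>2 / \<eta>\<^sup>2 + n * C"
    using n_pos by (simp add: norm_divide divide_le_eq mult.commute)
  have "cmod (E (\<lambda>\<omega>. (green_trace n z \<omega>)\<^sup>2)) \<le> Er (\<lambda>\<omega>. (1 / \<eta>)\<^sup>2)"
  proof (rule order_trans[OF cmod_E_le Er_mono])
    fix \<omega>
    have "cmod (green_trace n z \<omega>) \<le> 1 / \<eta>"
      unfolding green_trace_def by (rule cmod_mean_le) (use gb eta_pos in auto)
    then show "cmod ((green_trace n z \<omega>)\<^sup>2) \<le> (1 / \<eta>)\<^sup>2"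
      unfolding norm_power by (rule power_mono) simp
  qed
  then have "\<bar>1 - n * \<sigma>2\<bar> * cmod (E (\<lambda>\<omega>. (green_trace n z \<omega>)\<^sup>2)) \<le> \<bar>1 - n * \<sigma>2\<bar> * (1 / \<eta>\<^sup>2)"
    by (intro mult_left_mono) (auto simp: power_divide)
  moreover have "cmod (1 - n * \<sigma>2) = \<bar>1 - n * \<sigma>2\<bar>"
    by (metis norm_of_real of_real_1 of_real_diff of_real_mult of_real_of_nat_eq)
  ultimately have 2: "cmod ((1 - n * \<sigma>2) * E (\<lambda>\<omega>. (green_trace n z \<omega>)\<^sup>2)) \<le> \<bar>1 - n * \<sigma>2\<bar> / \<eta>\<^sup>2"
    by (simp add: norm_mult)
  have "cmod ((\<Sum>i<n. E (\<lambda>\<omega>. (G \<omega> i i)\<^sup>2)) / of_nat n) \<le> (1 / \<eta>)\<^sup>2"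
  proof (rule cmod_mean_le)
    fix i assume "i < n"
    then have "cmod (E (\<lambda>\<omega>. (G \<omega> i i)\<^sup>2)) \<le> Er (\<lambda>\<omega>. (1 / \<eta>)\<^sup>2)"
      by (intro order_trans[OF cmod_E_le Er_mono]) (auto simp: norm_power intro!: power_mono gb simp del: power_one_over)
    then show "cmod (E (\<lambda>\<omega>. (G \<omega> i i)\<^sup>2)) \<le> (1 / \<eta>)\<^sup>2" by simp
  qed simp
  then have "\<sigma>2 * cmod ((\<Sum>i<n. E (\<lambda>\<omega>. (G \<omega> i i)\<^sup>2)) / of_nat n) \<le> \<sigma>2 * (1 / \<eta>)\<^sup>2"
    using sigma2_nonneg by (rule mult_left_mono)
  then have 3: "cmod (\<sigma>2 / n * (\<Sum>i<n. E (\<lambda>\<omega>. (G \<omega> i i)\<^sup>2))) \<le> \<sigma>2 / \<eta>\<^sup>2"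
    using sigma2_nonneg by (simp add: norm_mult norm_divide power_divide)
  have "cmod (E (\<lambda>\<omega>. stieltjes_defect z (green_trace n z \<omega>))) \<le>
      (2 * \<sigma>2 / \<eta>\<^sup>2 + n * C) + \<bar>1 - n * \<sigma>2\<bar> / \<eta>\<^sup>2 + \<sigma>2 / \<eta>\<^sup>2"
    unfolding eq by (intro norm_triangle_le add_mono 1 2 3)
  also have "\<dots> = \<bar>1 - n * \<sigma>2\<bar> / \<eta>\<^sup>2 + 3 * \<sigma>2 / \<eta>\<^sup>2 + n * C" by (simp add: field_simps)
  finally show ?thesis by (simp add: C_def mult.assoc)
qed

end

end

section \<open>Concentration over rows\<close>

context wigner_pmf
begin

text \<open>The block \<open>{..<j} \<times> {j}\<close> consists of the edges with larger endpoint
  \<open>j\<close>. It affects only row and column \<open>j\<close>, so the minor without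
  \<open>j\<close> is common to both matrices.\<close>

lemma green_trace_diff_row:
  assumes z: "Im z > 0" and j: "j < n"
    and eq: "\<And>e. e \<notin> {..<j} \<times> {j} \<Longrightarrow> \<omega> e = \<omega>' e"
  shows "cmod (green_trace n z \<omega> - green_trace n z \<omega>') \<le> 2 / Im z / n"
proof -
  have "cmod ((\<Sum>i<n. green n \<omega> z i i) - (\<Sum>i<n. green n \<omega>' z i i)) \<le> 2 / Im z"
  proof (rule trace_resolvent_diff_row[OF finite_lessThan _ z hermitian_wigner_fun resolvent_green[OF z]
        hermitian_wigner_fun resolvent_green[OF z]])
    show "j \<in> {..<n}" using j by simp
    fix a b assume "a \<in> {..<n} - {j}" "b \<in> {..<n} - {j}"
    then show "wigner_fun \<omega> a b = wigner_fun \<omega>' a b"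
      using eq[of "(a, b)"] eq[of "(b, a)"] by (simp add: wigner_fun_def)
  qed
  then have "cmod ((\<Sum>i<n. green n \<omega> z i i) - (\<Sum>i<n. green n \<omega>' z i i)) / n \<le> 2 / Im z / n"
    by (rule divide_right_mono) simp
  then show ?thesis
    unfolding green_trace_def by (simp add: diff_divide_distrib[symmetric] norm_divide)
qed

lemma cmod_green_trace_le:
  assumes z: "Im z > 0"
  shows "cmod (green_trace n z \<omega>) \<le> 1 / Im z"
  unfolding green_trace_def by (rule cmod_mean_le) (use cmod_green_le[OF z] z in auto)

text \<open>The difference of two defects factors as (s - t) (z + s + t), hence is at most K / n.
  With n blocks the sum of squared differences is K^2 / n, which puts n into the exponent.\<close>

lemma defect_concentration:
  assumes z: "Im z > 0" and t: "t > 0"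
  defines "K \<equiv> (2 / Im z) * (cmod z + 2 / Im z)"
  shows "measure_pmf.prob p {\<omega>. cmod (stieltjes_defect z (green_trace n z \<omega>) -
      E (\<lambda>\<omega>. stieltjes_defect z (green_trace n z \<omega>))) \<ge> t} \<le> 4 * exp (- (t\<^sup>2 / (8 * K\<^sup>2)) * n)"
proof -
  define c where "c = K / n"
  have K: "K > 0" unfolding K_def using z by (intro mult_pos_pos add_nonneg_pos) auto
  have c: "c > 0" unfolding c_def using K n_pos by simp
  have edges: "possible_edges n = (\<Union>j\<in>{..<n}. {..<j} \<times> {j})"
    by (auto simp: possible_edges_def)
  have "measure_pmf.prob p {\<omega>. cmod (stieltjes_defect z (green_trace n z \<omega>) -
      E (\<lambda>\<omega>. stieltjes_defect z (green_trace n z \<omega>))) \<ge> t} \<le> 4 * exp (- (t\<^sup>2 / (8 * c\<^sup>2 * card {..<n})))"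
    unfolding p_def edges
  proof (rule McDiarmid_complex[OF finite_lessThan _ c t])
    fix j and \<omega> \<omega>' :: "nat \<times> nat \<Rightarrow> complex"
    assume j: "j \<in> {..<n}" and eq: "\<And>e. e \<notin> {..<j} \<times> {j} \<Longrightarrow> \<omega> e = \<omega>' e"
    let ?s = "green_trace n z \<omega>" and ?t = "green_trace n z \<omega>'"
    have "stieltjes_defect z ?s - stieltjes_defect z ?t = (?s - ?t) * (z + (?s + ?t))"
      by (simp add: stieltjes_defect_def algebra_simps power2_eq_square)
    moreover have "cmod (?s - ?t) * cmod (z + (?s + ?t)) \<le> (2 / Im z / n) * (cmod z + 2 / Im z)"
    proof (rule mult_mono)
      show "cmod (?s - ?t) \<le> 2 / Im z / n"
        using j eq by (intro green_trace_diff_row[OF z, of j]) auto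
      have "cmod (z + (?s + ?t)) \<le> cmod z + (cmod ?s + cmod ?t)"
        by (intro norm_triangle_le add_left_mono norm_triangle_ineq)
      then show "cmod (z + (?s + ?t)) \<le> cmod z + 2 / Im z"
        using cmod_green_trace_le[OF z, of \<omega>] cmod_green_trace_le[OF z, of \<omega>'] by simp
    qed (use z in auto)
    ultimately show "cmod (stieltjes_defect z ?s - stieltjes_defect z ?t) \<le> c"
      by (simp add: norm_mult c_def K_def)
  qed (use n_pos finite_P in \<open>auto simp: disjoint_family_on_def\<close>)
  also have "8 * c\<^sup>2 * card {..<n} = 8 * K\<^sup>2 / n"
    using n_pos by (simp add: c_def power_divide power2_eq_square)
  finally show ?thesis by simp
qed

lemma defect_tail:
  assumes z: "Im z > 0" and t: "t > 0"
  assumes "\<bar>1 - n * \<sigma>2\<bar> / (Im z)\<^sup>2 + 3 * \<sigma>2 / (Im z)\<^sup>2 + n * \<sigma>2 * \<delta> * (8 / Im z ^ 3 + 8 / Im z ^ 4) \<le> t / 2"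
  defines "K \<equiv> (2 / Im z) * (cmod z + 2 / Im z)"
  shows "measure_pmf.prob p {\<omega>. cmod (stieltjes_defect z (green_trace n z \<omega>)) \<ge> t} \<le> 4 * exp (- ((t / 2)\<^sup>2 / (8 * K\<^sup>2)) * n)"
proof -
  let ?D = "\<lambda>\<omega>. stieltjes_defect z (green_trace n z \<omega>)"
  have "cmod (E ?D) \<le> t / 2"
    by (rule order_trans[OF expected_defect_le[OF z] assms(3)])
  then have "t / 2 \<le> cmod (?D \<omega> - E ?D)" if "t \<le> cmod (?D \<omega>)" for \<omega>
    using norm_triangle_ineq2[of "?D \<omega>" "E ?D"] that by linarith
  then have "{\<omega>. cmod (?D \<omega>) \<ge> t} \<subseteq> {\<omega>. cmod (?D \<omega> - E ?D) \<ge> t / 2}"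
    by blast
  then have "measure_pmf.prob p {\<omega>. cmod (?D \<omega>) \<ge> t} \<le> measure_pmf.prob p {\<omega>. cmod (?D \<omega> - E ?D) \<ge> t / 2}"
    by (rule measure_pmf.finite_measure_mono) simp
  also have "\<dots> \<le> 4 * exp (- ((t / 2)\<^sup>2 / (8 * K\<^sup>2)) * n)"
    unfolding K_def by (rule defect_concentration[OF z]) (use t in simp)
  finally show ?thesis .
qed

end

section \<open>Almost sure convergence\<close>

text \<open>A single enumeration \<open>u\<close> serves the counting function and the trace for all
  z at once, as integration along a horizontal line requires.\<close>

lemma ex_eigenvalue_enumeration:
  fixes A :: "complex mat"
  assumes A: "A \<in> carrier_mat n n" and herm: "hermitian_on {..<n} (\<lambda>i j. A $$ (i, j))"
  obtains u :: "nat \<Rightarrow> real" where "\<And>x. esd A x = real (card {i. i < n \<and> u i \<le> x}) / real n"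
    and "\<And>z g. Im z > 0 \<Longrightarrow> resolvent_on {..<n} (\<lambda>i j. A $$ (i, j)) z g \<Longrightarrow>
      (\<Sum>i<n. g i i) / of_nat n = stieltjes n u z"
proof -
  obtain xs where xs: "mset xs = proots (char_poly A)" using ex_mset by blast
  have "char_poly A \<noteq> 0" using degree_monic_char_poly[OF A] by auto
  then have roots: "set xs = {\<mu>. poly (char_poly A) \<mu> = 0}"
    by (simp flip: set_mset_mset add: xs)
  have real: "Im \<mu> = 0" if "\<mu> \<in> set xs" for \<mu>
    using that hermitian_eigenvalue_real[OF A herm, of \<mu>] roots by blast
  have len: "length xs = n"
    using size_proots_complex[of "char_poly A"] degree_monic_char_poly[OF A] by (simp flip: xs)
  define u where "u i = Re (xs ! i)" for i
  have "esd A x = real (card {i. i < n \<and> u i \<le> x}) / real n" for x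
  proof -
    have "size {# \<mu> \<in># mset xs. Re \<mu> \<le> x #} = card {i. i < n \<and> u i \<le> x}"
      by (simp add: length_filter_conv_card len u_def flip: mset_filter)
    then show ?thesis using A by (simp add: esd_def xs)
  qed
  moreover have "(\<Sum>i<n. g i i) / of_nat n = stieltjes n u z"
    if z: "Im z > 0" and g: "resolvent_on {..<n} (\<lambda>i j. A $$ (i, j)) z g" for z g
  proof -
    have "Im z \<noteq> 0" using z by simp
    from ex_resolvent[OF A herm this] obtain h
      where h: "resolvent_on {..<n} (\<lambda>i j. A $$ (i, j)) z h"
        "(\<Sum>i<n. h i i) = (\<Sum>\<mu>\<in>#proots (char_poly A). 1 / (\<mu> - z))" by blast
    have "(\<Sum>i<n. g i i) = (\<Sum>i<n. h i i)"
      by (intro sum.cong refl resolvent_unique[OF finite_lessThan g h(1)])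
    also have "\<dots> = (\<Sum>\<mu>\<leftarrow>xs. 1 / (\<mu> - z))"
      unfolding h(2) xs[symmetric] by (metis mset_map sum_mset_sum_list)
    also have "\<dots> = (\<Sum>i<n. 1 / (xs ! i - z))"
      by (simp add: sum_list_sum_nth len atLeast0LessThan)
    also have "\<dots> = (\<Sum>i<n. 1 / (complex_of_real (u i) - z))"
    proof (rule sum.cong[OF refl])
      fix i assume "i \<in> {..<n}"
      then have "complex_of_real (u i) = xs ! i"
        using real[of "xs ! i"] len by (simp add: u_def complex_eq_iff)
      then show "1 / (xs ! i - z) = 1 / (complex_of_real (u i) - z)" by simp
    qed
    finally show ?thesis by (simp add: stieltjes_def)
  qed
  ultimately show ?thesis using that by blast
qed

text \<open>The first Borel-Cantelli lemma for each threshold 1 / (k + 1), and a countable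
  intersection. It asks for no independence between the \<open>X n\<close>.\<close>

lemma (in prob_space) AE_tendsto_zero_if_summable_tails:
  fixes X :: "nat \<Rightarrow> 'a \<Rightarrow> complex"
  assumes [measurable]: "\<And>n. X n \<in> borel_measurable M"
    and "\<And>t. t > 0 \<Longrightarrow> summable (\<lambda>n. prob {\<omega> \<in> space M. t \<le> cmod (X n \<omega>)})"
  shows "AE \<omega> in M. (\<lambda>n. X n \<omega>) \<longlonglongrightarrow> 0"
proof -
  have "AE \<omega> in M. \<forall>\<^sub>F n in sequentially. cmod (X n \<omega>) < 1 / real (Suc k)" for k
  proof -
    have "AE \<omega> in M. \<forall>\<^sub>F n in sequentially. \<omega> \<in> space M - {\<omega> \<in> space M. 1 / real (Suc k) \<le> cmod (X n \<omega>)}"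
      by (rule borel_cantelli_AE1) (use assms(2)[of "1 / real (Suc k)"] in \<open>auto simp: emeasure_eq_measure\<close>)
    then show ?thesis
      by eventually_elim (auto elim!: eventually_mono simp: not_le)
  qed
  then have "AE \<omega> in M. \<forall>k. \<forall>\<^sub>F n in sequentially. cmod (X n \<omega>) < 1 / real (Suc k)"
    by (simp add: AE_all_countable)
  then show ?thesis
  proof eventually_elim
    case (elim \<omega>)
    show ?case
    proof (rule tendstoI)
      fix e :: real assume "e > 0"
      then obtain k where k: "1 / real (Suc k) < e" using nat_approx_posE by blast
      show "\<forall>\<^sub>F n in sequentially. dist (X n \<omega>) 0 < e"
        using elim[rule_format, of k] by eventually_elim (use k in auto)
    qed
  qed
qed

section \<open>Randomly oriented graphs\<close>

text \<open>The entry of \<open>X / sqrt n\<close> above the diagonal that belongs to an entry \<open>s\<close> of the skew-adjacency matrix.\<close>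

definition entry_value :: "nat \<Rightarrow> real \<Rightarrow> real \<Rightarrow> real \<Rightarrow> complex"
  where "entry_value n p q s = - \<i> * complex_of_real ((s + p * (1 - 2 * q)) / (r_param p q * sqrt (real n)))"

text \<open>The value 0 off \<open>possible_edges\<close> matches the default of the product law, so
  that the distribution of the whole function can be identified.\<close>

definition graph_entries :: "nat \<Rightarrow> real \<Rightarrow> real \<Rightarrow> (nat \<times> nat) set \<Rightarrow> nat \<times> nat \<Rightarrow> complex"
  where "graph_entries n p q D e =
    (if e \<in> possible_edges n then entry_value n p q (skew_adjacency_mat n D $$ e) else 0)"

definition entry_pmf :: "nat \<Rightarrow> real \<Rightarrow> real \<Rightarrow> complex pmf"
  where "entry_pmf n p q = bernoulli_pmf p \<bind> (\<lambda>present. bernoulli_pmf q \<bind> (\<lambda>forward.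
    return_pmf (entry_value n p q (if present then if forward then 1 else - 1 else 0))))"

text \<open>All pairs in \<open>F\<close> are increasing, so an increasing arc can only come from a
  forward edge and a decreasing one only from a swapped edge.\<close>

lemma skew_adjacency_oriented:
  assumes F: "F \<subseteq> possible_edges n" and e: "e \<in> possible_edges n"
  shows "skew_adjacency_mat n ((\<lambda>e. if forward e then e else prod.swap e) ` F) $$ e =
    (if e \<in> F then if forward e then 1 else - 1 else 0)"
proof -
  obtain i j where ij: "e = (i, j)" "i < j" "j < n" using e by (auto simp: possible_edges_def)
  have lt: "a < b" if "(a, b) \<in> F" for a b using F that by (auto simp: possible_edges_def)
  have "(j, i) \<notin> F" using lt[of j i] ij(2) by auto
  let ?D = "(\<lambda>e. if forward e then e else prod.swap e) ` F"
  have "(i, j) \<in> ?D \<longleftrightarrow> (i, j) \<in> F \<and> forward (i, j)"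
    using ij(2) lt by (fastforce simp: image_iff split: if_splits)
  moreover have "(j, i) \<in> ?D \<longleftrightarrow> (i, j) \<in> F \<and> \<not> forward (i, j)"
    using ij(2) lt by (fastforce simp: image_iff split: if_splits)
  ultimately show ?thesis
    using ij \<open>(j, i) \<notin> F\<close> by (auto simp: skew_adjacency_mat_def simp del: if_image_distrib)
qed

text \<open>The graph is sampled in two stages, the second over a random edge set. Letting every
  possible edge draw an orientation makes the second stage a product over a fixed set, and the two
  stages merge coordinatewise.\<close>

lemma map_graph_entries_oriented_graph_pmf:
  "map_pmf (graph_entries n p q) (oriented_graph_pmf n p q) = Pi_pmf (possible_edges n) 0 (\<lambda>_. entry_pmf n p q)"
proof -
  define A where "A = possible_edges n"
  have fin: "finite A" unfolding A_def by (rule finite_possible_edges)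
  define val where "val present forward = entry_value n p q (if present then if forward then 1 else - 1 else 0)" for present forward
  have orient: "map_pmf (graph_entries n p q) (random_orientation_pmf q {e \<in> A. present e}) =
      Pi_pmf A 0 (\<lambda>e. bernoulli_pmf q \<bind> (\<lambda>forward. return_pmf (val (present e) forward)))" for present
  proof -
    let ?F = "{e \<in> A. present e}"
    have sub: "?F \<subseteq> A" by auto
    have "map_pmf (graph_entries n p q) (random_orientation_pmf q ?F) =
        map_pmf (\<lambda>forward. graph_entries n p q ((\<lambda>e. if forward e then e else prod.swap e) ` ?F)) (Pi_pmf ?F False (\<lambda>_. bernoulli_pmf q))"
      by (simp add: random_orientation_pmf_def pmf.map_comp comp_def)
    also have "\<dots> = map_pmf (\<lambda>forward e. if e \<in> A then val (present e) (forward e) else 0) (Pi_pmf ?F False (\<lambda>_. bernoulli_pmf q))"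
      by (intro map_pmf_cong refl ext)
        (use skew_adjacency_oriented[OF sub[unfolded A_def]] in \<open>simp add: graph_entries_def A_def val_def\<close>)
    \<comment> \<open>Absent edges now draw an orientation too, which \<open>val\<close>
      ignores.\<close>
    also have "\<dots> = map_pmf (\<lambda>forward e. if e \<in> A then val (present e) (forward e) else 0) (Pi_pmf A False (\<lambda>_. bernoulli_pmf q))"
      unfolding Pi_pmf_subset[OF fin sub] pmf.map_comp
      by (intro map_pmf_cong refl ext) (auto simp: val_def)
    also have "\<dots> = Pi_pmf A 0 (\<lambda>e. bernoulli_pmf q \<bind> (\<lambda>forward. return_pmf (val (present e) forward)))"
      unfolding Pi_pmf_bind[OF fin, where d' = False] by (simp add: fin map_pmf_def)
    finally show ?thesis .
  qed
  have "map_pmf (graph_entries n p q) (oriented_graph_pmf n p q) =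
      Pi_pmf A False (\<lambda>_. bernoulli_pmf p) \<bind> (\<lambda>present. map_pmf (graph_entries n p q) (random_orientation_pmf q {e \<in> A. present e}))"
    by (simp add: oriented_graph_pmf_def erdos_renyi_pmf_def map_bind_pmf bind_map_pmf A_def)
  also have "\<dots> = Pi_pmf A 0 (\<lambda>_. entry_pmf n p q)"
    unfolding orient entry_pmf_def val_def[symmetric] by (rule Pi_pmf_bind[OF fin, symmetric])
  finally show ?thesis by (simp add: A_def)
qed

lemma oriented_graph_asym:
  assumes "D \<in> set_pmf (oriented_graph_pmf n p q)" "(i, j) \<in> D"
  shows "(j, i) \<notin> D"
proof -
  from assms(1) obtain present forward
    where D: "D = (\<lambda>e. if forward e then e else prod.swap e) ` {e \<in> possible_edges n. present e}"
    by (auto simp: oriented_graph_pmf_def erdos_renyi_pmf_def random_orientation_pmf_def set_bind_pmf simp del: if_image_distrib)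
  define F where "F = {e \<in> possible_edges n. present e}"
  have lt: "a < b" if "(a, b) \<in> F" for a b using that by (auto simp: F_def possible_edges_def)
  show ?thesis
    using assms(2) lt[of i j] lt[of j i] unfolding D F_def[symmetric] by (auto split: if_splits)
qed

text \<open>Asymmetry matters: \<open>skew_adjacency_mat\<close> tests \<open>(i, j)\<close> before
  \<open>(j, i)\<close>, so two opposite arcs would give 1 at both places.\<close>

lemma scaled_X_mat_eq_wigner_fun:
  assumes asym: "\<And>i j. (i, j) \<in> D \<Longrightarrow> (j, i) \<notin> D" and ij: "i < n" "j < n"
  shows "(complex_of_real (1 / sqrt (real n)) \<cdot>\<^sub>m X_mat n p q (skew_adjacency_mat n D)) $$ (i, j) =
    wigner_fun (graph_entries n p q D) i j"
proof -
  have "skew_adjacency_mat n D $$ (i, i) = 0" using asym[of i i] ij by (auto simp: skew_adjacency_mat_def)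
  moreover have "skew_adjacency_mat n D $$ (j, i) = - (skew_adjacency_mat n D $$ (i, j))"
    using asym[of i j] asym[of j i] ij by (auto simp: skew_adjacency_mat_def)
  moreover have "skew_adjacency_mat n D \<in> carrier_mat n n" by (simp add: skew_adjacency_mat_def)
  ultimately show ?thesis
    using ij by (cases i j rule: linorder_cases)
      (auto simp: X_mat_def Y_mat_def wigner_fun_def graph_entries_def possible_edges_def entry_value_def field_simps)
qed

section \<open>Moments of an entry\<close>

lemma finite_set_entry_pmf: "finite (set_pmf (entry_pmf n p q))"
  unfolding entry_pmf_def by (auto simp: set_bind_pmf intro: finite_subset[OF subset_UNIV])

lemma expectation_entry_pmf:
  fixes f :: "complex \<Rightarrow> 'b::{banach, second_countable_topology, real_normed_algebra_1}"
  assumes "0 \<le> p" "p \<le> 1" "0 \<le> q" "q \<le> 1"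
  shows "measure_pmf.expectation (entry_pmf n p q) f =
    (p * q) *\<^sub>R f (entry_value n p q 1) + (p * (1 - q)) *\<^sub>R f (entry_value n p q (- 1)) + (1 - p) *\<^sub>R f (entry_value n p q 0)"
proof -
  have B: "measure_pmf.expectation (bernoulli_pmf a \<bind> K) f =
      a *\<^sub>R measure_pmf.expectation (K True) f + (1 - a) *\<^sub>R measure_pmf.expectation (K False) f"
    if "0 \<le> a" "a \<le> 1" "\<And>b. finite (set_pmf (K b))" for a K
    using that by (subst pmf_expectation_bind[of UNIV]) (auto simp: UNIV_bool)
  have fin: "finite (set_pmf (bernoulli_pmf a \<bind> (\<lambda>b. return_pmf (h b))))" for a and h :: "bool \<Rightarrow> complex"
    by (simp add: set_bind_pmf)
  have avg: "q *\<^sub>R x + (1 - q) *\<^sub>R x = x" for x :: 'b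
    by (simp add: scaleR_left_distrib[symmetric])
  show ?thesis
    unfolding entry_pmf_def B[OF assms(1,2) fin]
    by (simp add: B[OF assms(3,4)] avg scaleR_add_right)
qed

lemma r_param_square: "0 \<le> p \<Longrightarrow> p \<le> 1 \<Longrightarrow> 0 \<le> q \<Longrightarrow> q \<le> 1 \<Longrightarrow> (r_param p q)\<^sup>2 =
    (1 + p * (1 - 2 * q))\<^sup>2 * (p * q) + (1 - p * (1 - 2 * q))\<^sup>2 * (p * (1 - q))"
  unfolding r_param_def by (subst real_sqrt_pow2) (auto intro!: add_nonneg_nonneg mult_nonneg_nonneg)

text \<open>With c = p (1 - 2 q), the mean of s is p q - p (1 - q) = -c, so adding c centres it.
  Present edges contribute exactly r^2 to the variance of s + c, absent ones (1 - p) c^2; and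
  \<open>\<bar>s + c\<bar>\<close> is at most 2.\<close>

lemma wigner_pmf_entry_pmf:
  assumes pq: "0 \<le> p" "p \<le> 1" "0 \<le> q" "q \<le> 1" and n: "n > 0" and r: "r_param p q > 0"
    and small: "2 / (r_param p q * sqrt n) \<le> 1"
  shows "wigner_pmf n (entry_pmf n p q) (2 / (r_param p q * sqrt n))
    ((1 + (1 - p) * (p * (1 - 2 * q))\<^sup>2 / (r_param p q)\<^sup>2) / n)"
proof
  define c where "c = p * (1 - 2 * q)"
  define R where "R = r_param p q * sqrt n"
  have R: "R > 0" "R\<^sup>2 = (r_param p q)\<^sup>2 * n" using r n by (auto simp: R_def power_mult_distrib)
  have v: "entry_value n p q s = - \<i> * complex_of_real ((s + c) / R)" for s
    by (simp add: entry_value_def c_def R_def)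
  have cm: "cmod (entry_value n p q s) = \<bar>s + c\<bar> / R" for s
    unfolding v using R by (simp add: norm_mult del: of_real_divide)
  have "p * q * (1 + c) + p * (1 - q) * (- 1 + c) + (1 - p) * c = 0"
    unfolding c_def by (simp add: algebra_simps)
  moreover have "p * q * ((1 + c) / R) + p * (1 - q) * ((- 1 + c) / R) + (1 - p) * ((0 + c) / R) =
      (p * q * (1 + c) + p * (1 - q) * (- 1 + c) + (1 - p) * c) / R"
    using R by (simp add: field_simps)
  ultimately have mean: "p * q * ((1 + c) / R) + p * (1 - q) * ((- 1 + c) / R) + (1 - p) * ((0 + c) / R) = 0"
    by simp
  have lin: "(p * q) *\<^sub>R (- \<i> * complex_of_real x) + (p * (1 - q)) *\<^sub>R (- \<i> * complex_of_real y) + (1 - p) *\<^sub>R (- \<i> * complex_of_real w)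
      = - \<i> * complex_of_real (p * q * x + p * (1 - q) * y + (1 - p) * w)" for x y w
    by (simp add: scaleR_conv_of_real algebra_simps)
  have "measure_pmf.expectation (entry_pmf n p q) (\<lambda>x. x) =
      - \<i> * complex_of_real (p * q * ((1 + c) / R) + p * (1 - q) * ((- 1 + c) / R) + (1 - p) * ((0 + c) / R))"
    unfolding expectation_entry_pmf[OF pq] v lin ..
  then show "measure_pmf.expectation (entry_pmf n p q) (\<lambda>x. x) = 0" unfolding mean by simp
  have "measure_pmf.expectation (entry_pmf n p q) (\<lambda>x. (cmod x)\<^sup>2) =
      (p * q * (1 + c)\<^sup>2 + p * (1 - q) * (- 1 + c)\<^sup>2 + (1 - p) * c\<^sup>2) / R\<^sup>2"
    unfolding expectation_entry_pmf[OF pq] cm by (simp add: power_divide add_divide_distrib)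
  also have "p * q * (1 + c)\<^sup>2 + p * (1 - q) * (- 1 + c)\<^sup>2 = (r_param p q)\<^sup>2"
    unfolding r_param_square[OF pq] c_def[symmetric] by (simp add: algebra_simps power2_eq_square)
  also have "((r_param p q)\<^sup>2 + (1 - p) * c\<^sup>2) / R\<^sup>2 = (1 + (1 - p) * c\<^sup>2 / (r_param p q)\<^sup>2) / n"
    unfolding R using r n by (simp add: field_simps)
  finally show "measure_pmf.expectation (entry_pmf n p q) (\<lambda>x. (cmod x)\<^sup>2) =
      (1 + (1 - p) * (p * (1 - 2 * q))\<^sup>2 / (r_param p q)\<^sup>2) / n" by (simp add: c_def)
  fix x assume "x \<in> set_pmf (entry_pmf n p q)"
  then obtain s where s: "x = entry_value n p q s" "\<bar>s\<bar> \<le> 1"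
    by (auto simp: entry_pmf_def set_bind_pmf)
  have "\<bar>c\<bar> \<le> 1"
    unfolding c_def abs_mult using pq by (intro mult_le_one) auto
  then have "\<bar>s + c\<bar> \<le> 2" using s by linarith
  then show "cmod x \<le> 2 / (r_param p q * sqrt n)"
    unfolding s cm R_def[symmetric] using R by (simp add: divide_right_mono)
qed (use n small finite_set_entry_pmf in auto)

text \<open>r may tend to 0 together with c, so c -> 0 alone does not suffice. But c carries a
  factor p, whence c^2 \<le> p \<bar>c\<bar>, while r^2 \<ge> p / 2 because (1 + c)^2 and (1 - c)^2
  are at least 9 / 16.\<close>

lemma mean_square_le_r_param:
  assumes pq: "0 \<le> p" "p \<le> 1" "0 \<le> q" "q \<le> 1" and r: "r_param p q > 0"
    and c: "\<bar>p * (1 - 2 * q)\<bar> \<le> 1 / 4"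
  shows "(1 - p) * (p * (1 - 2 * q))\<^sup>2 / (r_param p q)\<^sup>2 \<le> 2 * \<bar>p * (1 - 2 * q)\<bar>"
proof -
  define c where "c = p * (1 - 2 * q)"
  have c': "\<bar>c\<bar> \<le> 1 / 4" using c by (simp add: c_def)
  then have "3 / 4 \<le> 1 + c" "3 / 4 \<le> 1 - c" by linarith+
  then have "(3 / 4)\<^sup>2 \<le> (1 + c)\<^sup>2" "(3 / 4)\<^sup>2 \<le> (1 - c)\<^sup>2" by (auto intro!: power_mono)
  then have sq: "1 / 2 \<le> (1 + c)\<^sup>2" "1 / 2 \<le> (1 - c)\<^sup>2" by (simp_all add: power_divide)
  have "p * (1 / 2) = (1 / 2) * (p * q) + (1 / 2) * (p * (1 - q))" by (simp add: field_simps)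
  also have "\<dots> \<le> (1 + c)\<^sup>2 * (p * q) + (1 - c)\<^sup>2 * (p * (1 - q))"
    using pq by (intro add_mono mult_right_mono sq) auto
  also have "\<dots> = (r_param p q)\<^sup>2" unfolding r_param_square[OF pq] c_def ..
  finally have r2: "p * (1 / 2) \<le> (r_param p q)\<^sup>2" .
  have "\<bar>c\<bar> \<le> p"
    unfolding c_def abs_mult using pq by (auto intro!: mult_left_le simp: abs_le_iff)
  have "(1 - p) * c\<^sup>2 \<le> 1 * c\<^sup>2" using pq by (intro mult_right_mono) auto
  also have "\<dots> = \<bar>c\<bar> * \<bar>c\<bar>" by (simp add: power2_eq_square)
  also have "\<dots> \<le> \<bar>c\<bar> * p" using \<open>\<bar>c\<bar> \<le> p\<close> by (rule mult_left_mono) simp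
  also have "\<dots> \<le> \<bar>c\<bar> * (2 * (r_param p q)\<^sup>2)" using r2 by (intro mult_left_mono) auto
  finally show ?thesis
    using r unfolding c_def[symmetric] by (simp add: divide_le_eq algebra_simps)
qed

lemma AE_defect_tendsto_0:
  fixes M :: "'a measure" and p q :: "nat \<Rightarrow> real" and G :: "nat \<Rightarrow> 'a \<Rightarrow> (nat \<times> nat) set"
  assumes M: "prob_space M"
    and p: "\<And>n. 0 \<le> p n \<and> p n \<le> 1"
    and q: "\<And>n. 0 \<le> q n \<and> q n \<le> 1"
    and G: "\<And>n. G n \<in> measurable M (count_space UNIV)"
    and law: "\<And>n. distr M (count_space UNIV) (G n) = measure_pmf (oriented_graph_pmf n (p n) (q n))"
    and nr: "filterlim (\<lambda>n. real n * (r_param (p n) (q n))\<^sup>2) at_top sequentially"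
    and c: "(\<lambda>n. p n * (1 - 2 * q n)) \<longlonglongrightarrow> 0"
    and z: "Im z > 0"
  shows "AE \<omega> in M. (\<lambda>n. stieltjes_defect z (green_trace n z (graph_entries n (p n) (q n) (G n \<omega>)))) \<longlonglongrightarrow> 0"
proof (rule prob_space.AE_tendsto_zero_if_summable_tails[OF M])
  let ?\<phi> = "\<lambda>n D. stieltjes_defect z (green_trace n z (graph_entries n (p n) (q n) D))"
  show "(\<lambda>\<omega>. ?\<phi> n (G n \<omega>)) \<in> borel_measurable M" for n
    by (rule measurable_compose[OF G]) simp
  fix t :: real assume t: "t > 0"
  define r where "r n = r_param (p n) (q n)" for n
  define c' where "c' n = p n * (1 - 2 * q n)" for n
  define \<delta> where "\<delta> n = 2 / (r n * sqrt (real n))" for n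
  define v where "v n = 1 + (1 - p n) * (c' n)\<^sup>2 / (r n)\<^sup>2" for n
  have r_nonneg: "r n \<ge> 0" for n
    unfolding r_def r_param_def using p q by (auto intro!: add_nonneg_nonneg mult_nonneg_nonneg)
  have nr': "filterlim (\<lambda>n. real n * (r n)\<^sup>2) at_top sequentially" unfolding r_def by (rule nr)
  have ev_r: "\<forall>\<^sub>F n in sequentially. r n > 0 \<and> n > 0"
    using filterlim_at_top_dense[THEN iffD1, rule_format, OF nr', of 0]
  proof eventually_elim
    case (elim n)
    then have "r n \<noteq> 0" "n \<noteq> 0" by (cases "n = 0"; cases "r n = 0"; simp)+
    then show ?case using r_nonneg[of n] by simp
  qed
  have "(\<lambda>n. 2 / sqrt (real n * (r n)\<^sup>2)) \<longlonglongrightarrow> 0"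
    by (intro real_tendsto_divide_at_top[OF tendsto_const] filterlim_compose[OF sqrt_at_top nr'])
  moreover have "\<delta> = (\<lambda>n. 2 / sqrt (real n * (r n)\<^sup>2))"
    using r_nonneg by (simp add: \<delta>_def[abs_def] real_sqrt_mult mult.commute)
  ultimately have \<delta>: "\<delta> \<longlonglongrightarrow> 0" by simp
  have c0: "c' \<longlonglongrightarrow> 0" unfolding c'_def by (rule c)
  have ev_c: "\<forall>\<^sub>F n in sequentially. \<bar>c' n\<bar> < 1 / 4"
    using order_tendstoD(2)[OF tendsto_rabs_zero[OF c0], of "1/4"] by simp
  have "(\<lambda>n. v n - 1) \<longlonglongrightarrow> 0"
  proof (rule tendsto_sandwich[OF _ _ tendsto_const])
    show "\<forall>\<^sub>F n in sequentially. 0 \<le> v n - 1"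
      using p by (intro always_eventually) (auto simp: v_def intro!: divide_nonneg_nonneg mult_nonneg_nonneg)
    show "\<forall>\<^sub>F n in sequentially. v n - 1 \<le> 2 * \<bar>c' n\<bar>"
      using ev_r ev_c
    proof eventually_elim
      case (elim n)
      then show ?case
        using mean_square_le_r_param[of "p n" "q n"] p[of n] q[of n] by (simp add: v_def r_def c'_def)
    qed
    show "(\<lambda>n. 2 * \<bar>c' n\<bar>) \<longlonglongrightarrow> 0"
      using tendsto_mult_right_zero[OF tendsto_rabs_zero[OF c0], of 2] by simp
  qed
  then have v: "v \<longlonglongrightarrow> 1" by (simp add: LIM_zero_iff)
  \<comment> \<open>The bound of \<open>expected_defect_le\<close> for the variance
    \<open>v n / n\<close>.\<close>
  have "(\<lambda>n. \<bar>1 - v n\<bar> / (Im z)\<^sup>2 + 3 * (v n * (1 / real n)) / (Im z)\<^sup>2 + v n * \<delta> n * (8 / Im z ^ 3 + 8 / Im z ^ 4)) \<longlonglongrightarrow>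
      \<bar>1 - 1\<bar> / (Im z)\<^sup>2 + 3 * (1 * 0) / (Im z)\<^sup>2 + 1 * 0 * (8 / Im z ^ 3 + 8 / Im z ^ 4)"
    by (intro tendsto_intros v \<delta> lim_1_over_n) (use z in auto)
  then have ev_bound: "\<forall>\<^sub>F n in sequentially. \<bar>1 - v n\<bar> / (Im z)\<^sup>2 + 3 * (v n * (1 / real n)) / (Im z)\<^sup>2 +
      v n * \<delta> n * (8 / Im z ^ 3 + 8 / Im z ^ 4) < t / 2"
    using t by (intro order_tendstoD(2)) auto
  have ev_\<delta>: "\<forall>\<^sub>F n in sequentially. \<delta> n < 1" using order_tendstoD(2)[OF \<delta>, of 1] by simp
  define K where "K = (2 / Im z) * (cmod z + 2 / Im z)"
  have K: "K > 0" unfolding K_def using z by (intro mult_pos_pos add_nonneg_pos) auto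
  \<comment> \<open>Half of t is spent on the expectation, the other half on the
    fluctuation.\<close>
  define \<kappa> where "\<kappa> = (t / 2)\<^sup>2 / (8 * K\<^sup>2)"
  have \<kappa>: "\<kappa> > 0" using K t by (simp add: \<kappa>_def)
  have "summable (\<lambda>n. 4 * exp (- \<kappa>) ^ n)"
    using \<kappa> by (intro summable_mult summable_geometric) simp
  moreover have "\<forall>\<^sub>F n in sequentially.
    norm (measure M {\<omega> \<in> space M. t \<le> cmod (?\<phi> n (G n \<omega>))}) \<le> 4 * exp (- \<kappa>) ^ n"
    using ev_r ev_bound ev_\<delta>
  proof eventually_elim
    case (elim n)
    have pq: "0 \<le> p n" "p n \<le> 1" "0 \<le> q n" "q n \<le> 1" using p q by auto
    interpret wigner_pmf n "entry_pmf n (p n) (q n)" "\<delta> n" "v n / n"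
      unfolding \<delta>_def v_def r_def c'_def
      by (rule wigner_pmf_entry_pmf[OF pq]) (use elim in \<open>simp_all add: \<delta>_def r_def\<close>)
    \<comment> \<open>The event depends on the graph alone, so its probability passes to the law of
      the graph and on to the product law of the entries.\<close>
    have "measure M {\<omega> \<in> space M. t \<le> cmod (?\<phi> n (G n \<omega>))} =
        measure (distr M (count_space UNIV) (G n)) {D. t \<le> cmod (?\<phi> n D)}"
      by (subst measure_distr[OF G]) (auto intro!: arg_cong[of _ _ "measure M"])
    also have "\<dots> = measure_pmf.prob (map_pmf (graph_entries n (p n) (q n)) (oriented_graph_pmf n (p n) (q n)))
        {w. t \<le> cmod (stieltjes_defect z (green_trace n z w))}"
      by (simp add: law vimage_def)
    also have "\<dots> \<le> 4 * exp (- \<kappa> * n)"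
      unfolding map_graph_entries_oriented_graph_pmf p_def[symmetric] \<kappa>_def K_def
      by (rule defect_tail[OF z t]) (use elim in \<open>simp add: field_simps\<close>)
    also have "exp (- \<kappa> * n) = exp (- \<kappa>) ^ n"
      by (simp add: exp_of_nat_mult[symmetric] mult.commute)
    finally show ?case by simp
  qed
  ultimately show "summable (\<lambda>n. measure M {\<omega> \<in> space M. t \<le> cmod (?\<phi> n (G n \<omega>))})"
    by (rule summable_comparison_test_ev[rotated])
qed

theorem theorem1:
  fixes M :: "'a measure"
    and p q :: "nat \<Rightarrow> real"
    and G :: "nat \<Rightarrow> 'a \<Rightarrow> (nat \<times> nat) set"
  assumes "prob_space M"
    and "\<And>n. 0 \<le> p n \<and> p n \<le> 1"
    and "\<And>n. 0 \<le> q n \<and> q n \<le> 1"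
    and "\<And>n. G n \<in> measurable M (count_space UNIV)"
    and "\<And>n. distr M (count_space UNIV) (G n) = measure_pmf (oriented_graph_pmf n (p n) (q n))"
    and "filterlim (\<lambda>n. real n * (r_param (p n) (q n))\<^sup>2) at_top sequentially"
    and "(\<lambda>n. p n * (1 - 2 * q n)) \<longlonglongrightarrow> 0"
  defines "F_emp \<equiv> \<lambda>n \<omega>. esd (complex_of_real (1 / sqrt (real n)) \<cdot>\<^sub>m
             X_mat n (p n) (q n) (skew_adjacency_mat n (G n \<omega>)))"
  shows "AE \<omega> in M. weak_conv (\<lambda>n. F_emp n \<omega>) semicircle_cdf
           \<and> (\<forall>x. (\<lambda>n. F_emp n \<omega> x) \<longlonglongrightarrow> semicircle_cdf x)"
proof -
  let ?z = "\<lambda>(x, k). Complex x (1 / real k)"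
  let ?e = "\<lambda>n \<omega>. graph_entries n (p n) (q n) (G n \<omega>)"
  \<comment> \<open>The exceptional null set depends on z; countably many z keep the union
    null.\<close>
  have "AE \<omega> in M. \<forall>xk\<in>\<rat> \<times> {0<..}. (\<lambda>n. stieltjes_defect (?z xk) (green_trace n (?z xk) (?e n \<omega>))) \<longlonglongrightarrow> 0"
    by (subst AE_ball_countable)
      (auto intro!: AE_defect_tendsto_0 assms countable_rat)
  \<comment> \<open>Only the law of \<open>G n\<close> is given, so its values are oriented graphs
    merely almost surely.\<close>
  moreover have "AE \<omega> in M. \<forall>n. \<forall>i j. (i, j) \<in> G n \<omega> \<longrightarrow> (j, i) \<notin> G n \<omega>"
    unfolding AE_all_countable
  proof (intro allI)
    fix n i j
    have "AE D in distr M (count_space UNIV) (G n). (i, j) \<in> D \<longrightarrow> (j, i) \<notin> D"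
      unfolding assms(5) by (rule AE_pmfI) (use oriented_graph_asym in blast)
    then show "AE \<omega> in M. (i, j) \<in> G n \<omega> \<longrightarrow> (j, i) \<notin> G n \<omega>"
      by (rule AE_distrD[OF assms(4)])
  qed
  ultimately have "AE \<omega> in M. \<forall>x. (\<lambda>n. F_emp n \<omega> x) \<longlonglongrightarrow> semicircle_cdf x"
  proof eventually_elim
    case (elim \<omega>)
    define A where "A n = complex_of_real (1 / sqrt (real n)) \<cdot>\<^sub>m X_mat n (p n) (q n) (skew_adjacency_mat n (G n \<omega>))" for n
    have A: "A n \<in> carrier_mat n n" for n
      by (rule carrier_matI) (simp_all add: A_def X_mat_def Y_mat_def)
    have entry: "A n $$ (i, j) = wigner_fun (?e n \<omega>) i j" if "i \<in> {..<n}" "j \<in> {..<n}" for n i j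
      unfolding A_def using elim(2) that by (intro scaled_X_mat_eq_wigner_fun) auto
    have herm: "hermitian_on {..<n} (\<lambda>i j. A n $$ (i, j))" for n
      unfolding hermitian_on_def
    proof (intro ballI)
      fix i j assume ij: "i \<in> {..<n}" "j \<in> {..<n}"
      show "A n $$ (j, i) = cnj (A n $$ (i, j))"
        unfolding entry[OF ij] entry[OF ij(2,1)] by (simp add: wigner_fun_def)
    qed
    have "\<forall>n. \<exists>u. (\<forall>x. esd (A n) x = real (card {i. i < n \<and> u i \<le> x}) / real n) \<and>
        (\<forall>z. Im z > 0 \<longrightarrow> green_trace n z (?e n \<omega>) = stieltjes n u z)"
    proof
      fix n
      obtain u where u: "\<And>x. esd (A n) x = real (card {i. i < n \<and> u i \<le> x}) / real n"
        "\<And>z g. Im z > 0 \<Longrightarrow> resolvent_on {..<n} (\<lambda>i j. A n $$ (i, j)) z g \<Longrightarrow>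
          (\<Sum>i<n. g i i) / of_nat n = stieltjes n u z"
        using ex_eigenvalue_enumeration[OF A herm] by blast
      have "green_trace n z (?e n \<omega>) = stieltjes n u z" if z: "Im z > 0" for z
      proof -
        have "resolvent_on {..<n} (\<lambda>i j. A n $$ (i, j)) z (green n (?e n \<omega>) z)"
          using resolvent_green[OF z] resolvent_on_cong[of "{..<n}" "\<lambda>i j. A n $$ (i, j)", OF entry] by blast
        then show ?thesis unfolding green_trace_def by (rule u(2)[OF z])
      qed
      then show "\<exists>u. (\<forall>x. esd (A n) x = real (card {i. i < n \<and> u i \<le> x}) / real n) \<and>
          (\<forall>z. Im z > 0 \<longrightarrow> green_trace n z (?e n \<omega>) = stieltjes n u z)"
        using u(1) by blast
    qed
    from choice[OF this] obtain u where u: "\<And>n x. esd (A n) x = real (card {i. i < n \<and> u n i \<le> x}) / real n"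
      "\<And>n z. Im z > 0 \<Longrightarrow> green_trace n z (?e n \<omega>) = stieltjes n (u n) z"
      by blast
    have "(\<lambda>n. real (card {i. i < n \<and> u n i \<le> x}) / real n) \<longlonglongrightarrow> semicircle_cdf x" for x
    proof (rule empirical_cdf_tendsto_semicircle)
      fix y :: real and k :: nat assume yk: "y \<in> \<rat>" "k > 0"
      then have "(\<lambda>n. stieltjes_defect (?z (y, k)) (green_trace n (?z (y, k)) (?e n \<omega>))) \<longlonglongrightarrow> 0"
        by (intro elim(1)[rule_format]) auto
      then show "(\<lambda>n. stieltjes_defect (Complex y (1 / real k)) (stieltjes n (u n) (Complex y (1 / real k)))) \<longlonglongrightarrow> 0"
        using yk(2) by (simp add: u(2))
    qed
    then show ?case unfolding F_emp_def A_def[symmetric] u(1) by blast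
  qed
  then show ?thesis
    by eventually_elim (simp add: weak_conv_def)
qed

end
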